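(* Let $\alpha>0$ and $k\in\mathbb{R}$. There is a universal entire function $s\mapsto I^\alpha(k,s)$ (depending only on $\alpha$ and $k$, not on the form considered), satisfying $$I^\alpha(k,s)=I^\alpha(k,k-s),$$ such that for every form $F(\delta)=\sum_{n=0}^\infty a_ne^{-2\pi(\Delta+n)\delta}$ with $\Delta>0$, converging for $\operatorname{Re}\delta>0$ and satisfying $F(1/\delta)=\delta^kF(\delta)$, the Mellin transform $R^\alpha$ of its $T\overline T$ deformation $F^\alpha$ is related to the Mellin transform $R^0$ of $F$ by $$R^\alpha(s)=I^\alpha(k,s)\,R^0(s).$$ Consequently $R^\alpha$ inherits the reflection property ($R^\alpha(s)=R^\alpha(k-s)$) and the zeroes of $R^0$.
   Context: The $T\overline T$ deformation of $F$ with parameter $\alpha>0$ is $$F^\alpha(\delta)=\sum_{n=0}^\infty a_n\,\frac{\bigl(1+\sqrt{1+8\pi(\Delta+n)\alpha\delta}\bigr)^{1-k}}{\sqrt{1+8\pi(\Delta+n)\alpha\delta}}\;e^{-\frac{1}{2\alpha}\left(\sqrt{1+8\pi(\Delta+n)\alpha\delta}-1\right)},$$ with principal branches (the overall constant normalization of $F^\alpha$, which may depend on $k$ only, is immaterial since it is absorbed into $I^\alpha(k,s)$). The Mellin transforms, taken at fixed $\alpha$, are $$R^0(s)=\int_0^\infty\delta^{s-1}F(\delta)\,d\delta,\qquad R^\alpha(s)=\int_0^\infty\delta^{s-1}F^\alpha(\delta)\,d\delta,$$ for $\operatorname{Re}s>k$, and by analytic continuation elsewhere. The modular property of $F$ gives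 the reflection property $R^0(s)=R^0(k-s)$. *)

theory Defs
  imports "HOL-Complex_Analysis.Complex_Analysis"
begin

definition form_term :: "real \<Rightarrow> (nat \<Rightarrow> complex) \<Rightarrow> nat \<Rightarrow> complex \<Rightarrow> complex" where
  "form_term \<Delta> a n \<delta> = a n * exp (- complex_of_real (2 * pi * (\<Delta> + real n)) * \<delta>)"

definition form_series :: "real \<Rightarrow> (nat \<Rightarrow> complex) \<Rightarrow> complex \<Rightarrow> complex" where
  "form_series \<Delta> a \<delta> = (\<Sum>n. form_term \<Delta> a n \<delta>)"

text \<open>
  A form of weight \<open>k\<close> is given by its exponent \<open>\<Delta>\<close> and its coefficients \<open>a\<close>.  Complex powers
  (\<open>powr\<close>) and square roots (\<open>csqrt\<close>) are the principal branches.
\<close>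

definition modular_form_data :: "real \<Rightarrow> real \<Rightarrow> (nat \<Rightarrow> complex) \<Rightarrow> bool" where
  "modular_form_data k \<Delta> a \<longleftrightarrow>
     \<Delta> > 0 \<and>
     (\<forall>\<delta>. Re \<delta> > 0 \<longrightarrow> summable (\<lambda>n. form_term \<Delta> a n \<delta>)) \<and>
     (\<forall>\<delta>. Re \<delta> > 0 \<longrightarrow>
        form_series \<Delta> a (1 / \<delta>) = \<delta> powr complex_of_real k * form_series \<Delta> a \<delta>)"

definition TTbar_root :: "real \<Rightarrow> real \<Rightarrow> nat \<Rightarrow> complex \<Rightarrow> complex" where
  "TTbar_root \<alpha> \<Delta> n \<delta> = csqrt (1 + complex_of_real (8 * pi * (\<Delta> + real n) * \<alpha>) * \<delta>)"

definition TTbar_term ::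
    "real \<Rightarrow> real \<Rightarrow> real \<Rightarrow> (nat \<Rightarrow> complex) \<Rightarrow> nat \<Rightarrow> complex \<Rightarrow> complex" where
  "TTbar_term \<alpha> k \<Delta> a n \<delta> =
     a n * ((1 + TTbar_root \<alpha> \<Delta> n \<delta>) powr complex_of_real (1 - k) / TTbar_root \<alpha> \<Delta> n \<delta>)
         * exp (- complex_of_real (1 / (2 * \<alpha>)) * (TTbar_root \<alpha> \<Delta> n \<delta> - 1))"

definition TTbar_deformation ::
    "real \<Rightarrow> real \<Rightarrow> real \<Rightarrow> (nat \<Rightarrow> complex) \<Rightarrow> complex \<Rightarrow> complex" where
  "TTbar_deformation \<alpha> k \<Delta> a \<delta> = (\<Sum>n. TTbar_term \<alpha> k \<Delta> a n \<delta>)"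

definition mellin_integrand :: "(complex \<Rightarrow> complex) \<Rightarrow> complex \<Rightarrow> real \<Rightarrow> complex" where
  "mellin_integrand f s \<delta> = complex_of_real \<delta> powr (s - 1) * f (complex_of_real \<delta>)"

text \<open>
  \<open>R\<close> is the Mellin transform of \<open>f\<close>: the absolutely convergent Mellin integral for \<open>Re s > k\<close>,
  and its analytic continuation to the whole plane elsewhere.  By the identity theorem there is at
  most one such \<open>R\<close>.
\<close>

definition is_mellin_transform ::
    "real \<Rightarrow> (complex \<Rightarrow> complex) \<Rightarrow> (complex \<Rightarrow> complex) \<Rightarrow> bool" where
  "is_mellin_transform k f R \<longleftrightarrow>
     R holomorphic_on UNIV \<and>
     (\<forall>s. Re s > k \<longrightarrow>
        set_integrable lborel {0<..} (mellin_integrand f s) \<and>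
        R s = (LINT \<delta>:{0<..}|lborel. mellin_integrand f s \<delta>))"

end

theory Submission
  imports Defs "HOL-Probability.Distributions"
begin

text \<open>
  With \<open>w = sqrt (1 + 4 \<alpha> x)\<close>, the function \<open>(1 + w) powr (1 - k) / w * exp (- (w - 1) / (2 \<alpha>))\<close> is, for
  \<open>k > 0\<close>, the integral of \<open>exp (- x exp (2 y))\<close> against \<open>exp (k y) \<phi> (2 cosh y) dy\<close>, for a positive \<open>\<phi>\<close> that makes
  \<open>\<phi> (2 cosh y)\<close> decay faster than any Gaussian.  Hence on the positive half-line, in the coordinate
  \<open>\<delta> = exp x\<close>, the deformation is a convolution of \<open>F\<close> with this kernel, and the Mellin transform (a
  two-sided Laplace transform in \<open>x\<close>) becomes a product.  The factor is the integral of
  \<open>exp ((k - 2 s) y) \<phi> (2 cosh y)\<close>, which is entire, and invariant under \<open>s \<mapsto> k - s\<close> because \<open>cosh\<close> is even.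

  Interchanging sum and integral needs polynomial growth of the coefficients, which is Hecke's bound:
  \<open>(Re \<delta>) powr (k / 2) * \<bar>F \<delta>\<bar>\<close> is invariant under \<open>\<delta> \<mapsto> 1 / \<delta>\<close> and \<open>\<delta> \<mapsto> \<delta> + \<i>\<close>, hence bounded.  The same
  bound (for \<open>k = 0\<close> together with the maximum principle) shows that no nonzero forms exist for \<open>k \<le> 0\<close>,
  so that the factor \<open>0\<close> is correct there.
\<close>

subsection \<open>Two-sided Laplace transforms of Gaussian-dominated functions\<close>

lemma gaussian_has_bochner_integral:
  fixes c :: real
  assumes "c > 0"
  shows "has_bochner_integral lborel (\<lambda>x. exp (- c * x\<^sup>2)) (sqrt (pi / c))"
proof -
  have "has_bochner_integral lborel (\<lambda>x. exp (- x\<^sup>2) :: real) (sqrt pi)"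
    using has_bochner_integral_even_function[OF gaussian_moment_0] by simp
  then have "has_bochner_integral lborel (\<lambda>x. exp (- (0 + sqrt c * x)\<^sup>2) :: real) (sqrt pi /\<^sub>R \<bar>sqrt c\<bar>)"
    using assms by (subst (asm) lborel_has_bochner_integral_real_affine_iff[where c="sqrt c" and t=0]) auto
  then show ?thesis
    using assms by (simp add: power_mult_distrib real_sqrt_divide field_simps)
qed

text \<open>Completing the square with \<open>(c - d * \<bar>x\<bar>)\<^sup>2\<close>: half of the
  Gaussian rate is spent to absorb an arbitrary exponential factor.\<close>

lemma gaussian_times_exp_abs_le:
  fixes c d x :: real
  assumes "d > 0"
  shows "exp (c * \<bar>x\<bar>) * exp (- d * x\<^sup>2) \<le> exp (c\<^sup>2 / (2 * d)) * exp (- (d / 2) * x\<^sup>2)"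
proof -
  have "0 \<le> (c - d * \<bar>x\<bar>)\<^sup>2 / (2 * d)" using assms by simp
  also have "\<dots> = c\<^sup>2 / (2 * d) - c * \<bar>x\<bar> + (d / 2) * x\<^sup>2"
    using assms by (simp add: power2_diff field_simps power2_eq_square)
  finally show ?thesis by (simp add: exp_add[symmetric] field_simps)
qed

text \<open>A class on which the two-sided Laplace transform converges for every complex argument.
  Both the form in the coordinate \<open>\<delta> = exp x\<close> and the kernel belong to
  it.\<close>

definition gauss_dominated :: "(real \<Rightarrow> complex) \<Rightarrow> bool" where
  "gauss_dominated h \<longleftrightarrow> h \<in> borel_measurable borel \<and>
     (\<exists>B d. d > 0 \<and> (\<forall>x. norm (h x) \<le> B * exp (- d * x\<^sup>2)))"

text \<open>Room for \<open>exp (c * \<bar>x\<bar>)\<close> serves two purposes: multiplication by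
  an exponential, and the factor that inversion puts on a form at negative \<open>x\<close>.\<close>

lemma gauss_dominatedI:
  fixes c :: real
  assumes "h \<in> borel_measurable borel" "d > 0"
    and le: "\<And>x. norm (h x) \<le> B * exp (c * \<bar>x\<bar>) * exp (- d * x\<^sup>2)"
  shows "gauss_dominated h"
proof -
  have B: "B \<ge> 0" using order_trans[OF norm_ge_zero le[of 0]] by simp
  have "norm (h x) \<le> (B * exp (c\<^sup>2 / (2 * d))) * exp (- (d / 2) * x\<^sup>2)" for x
    using le[of x] mult_left_mono[OF gaussian_times_exp_abs_le[OF \<open>d > 0\<close>, of c x] B]
    by (simp add: mult.assoc)
  moreover have "d / 2 > 0" using assms by simp
  ultimately show ?thesis unfolding gauss_dominated_def using assms(1) by blast
qed

lemma gauss_dominated_measurable [measurable]: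
  "gauss_dominated h \<Longrightarrow> h \<in> borel_measurable borel"
  by (simp add: gauss_dominated_def)

lemma gauss_dominated_integrable_abs:
  assumes "gauss_dominated h"
  shows "integrable lborel (\<lambda>x. exp (c * \<bar>x\<bar>) * norm (h x))"
proof -
  note [measurable] = gauss_dominated_measurable[OF assms]
  obtain B d where d: "d > 0" and le: "\<And>x. norm (h x) \<le> B * exp (- d * x\<^sup>2)"
    using assms unfolding gauss_dominated_def by blast
  have B: "B \<ge> 0" using order_trans[OF norm_ge_zero le[of 0]] by simp
  have "integrable lborel (\<lambda>x::real. (B * exp (c\<^sup>2 / (2 * d))) * exp (- (d / 2) * x\<^sup>2))"
    using gaussian_has_bochner_integral[of "d / 2"] d
    by (intro integrable_mult_right) (auto simp: has_bochner_integral_iff)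
  then show ?thesis
  proof (rule Bochner_Integration.integrable_bound)
    have "exp (c * \<bar>x\<bar>) * norm (h x) \<le> B * exp (c\<^sup>2 / (2 * d)) * exp (- (d / 2) * x\<^sup>2)" for x
    proof -
      have "exp (c * \<bar>x\<bar>) * norm (h x) \<le> exp (c * \<bar>x\<bar>) * (B * exp (- d * x\<^sup>2))"
        by (intro mult_left_mono le) simp
      also have "\<dots> = B * (exp (c * \<bar>x\<bar>) * exp (- d * x\<^sup>2))" by simp
      also have "\<dots> \<le> B * (exp (c\<^sup>2 / (2 * d)) * exp (- (d / 2) * x\<^sup>2))"
        by (intro mult_left_mono gaussian_times_exp_abs_le d B)
      finally show ?thesis by (simp add: mult.assoc)
    qed
    then show "AE x in lborel. norm (exp (c * \<bar>x\<bar>) * norm (h x))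
        \<le> norm (B * exp (c\<^sup>2 / (2 * d)) * exp (- (d / 2) * x\<^sup>2))"
      using B by simp
  qed measurable
qed

lemma gauss_dominated_exp_mult:
  assumes "gauss_dominated h"
  shows "gauss_dominated (\<lambda>x. exp (c * of_real x) * h x)"
proof -
  note [measurable] = gauss_dominated_measurable[OF assms]
  obtain B d where d: "d > 0" and le: "\<And>x. norm (h x) \<le> B * exp (- d * x\<^sup>2)"
    using assms unfolding gauss_dominated_def by blast
  show ?thesis
  proof (rule gauss_dominatedI[OF _ d])
    fix x
    have "Re c * x \<le> \<bar>Re c\<bar> * \<bar>x\<bar>" by (metis abs_ge_self abs_mult)
    then have "norm (exp (c * of_real x) * h x) \<le> exp (\<bar>Re c\<bar> * \<bar>x\<bar>) * (B * exp (- d * x\<^sup>2))"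
      using le[of x] by (auto simp: norm_mult intro!: mult_mono)
    then show "norm (exp (c * of_real x) * h x) \<le> B * exp (\<bar>Re c\<bar> * \<bar>x\<bar>) * exp (- d * x\<^sup>2)"
      by (simp add: mult_ac)
  qed measurable
qed

text \<open>The sign of the exponent is chosen so that the substitution
  \<open>\<delta> = exp x\<close> turns a Mellin transform at \<open>s\<close> into this integral at
  the same \<open>s\<close>.\<close>

definition laplace2 :: "(real \<Rightarrow> complex) \<Rightarrow> complex \<Rightarrow> complex" where
  "laplace2 h s = (\<integral>x. exp (s * of_real x) * h x \<partial>lborel)"

lemma gauss_dominated_integrable:
  assumes "gauss_dominated h"
  shows "integrable lborel (\<lambda>x. exp (s * of_real x) * h x)"
proof -
  note [measurable] = gauss_dominated_measurable[OF assms]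
  have *: "Re s * x \<le> \<bar>Re s\<bar> * \<bar>x\<bar>" for x
    by (metis abs_ge_self abs_mult)
  show ?thesis
    by (rule Bochner_Integration.integrable_bound[OF gauss_dominated_integrable_abs[OF assms, of "\<bar>Re s\<bar>"]])
       (use * in \<open>auto simp: norm_mult intro!: mult_right_mono\<close>)
qed

text \<open>Expanding \<open>exp (s * x)\<close> in powers of \<open>s\<close> and integrating
  termwise, with majorant \<open>exp (norm s * \<bar>x\<bar>) * norm (h x)\<close>, gives a power
  series that converges everywhere.\<close>

lemma laplace2_holomorphic:
  assumes "gauss_dominated h"
  shows "laplace2 h holomorphic_on UNIV"
proof -
  note [measurable] = gauss_dominated_measurable[OF assms]
  define c where "c n = (\<integral>x. (of_real x ^ n / fact n) * h x \<partial>lborel)" for n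
  have sums: "(\<lambda>n. c n * (s - 0) ^ n) sums laplace2 h s" for s
  proof -
    define f where "f n x = ((s * of_real x) ^ n / fact n) * h x" for n and x :: real
    have exp_sums: "(\<lambda>n. (norm s * \<bar>x\<bar>) ^ n / fact n * norm (h x)) sums (exp (norm s * \<bar>x\<bar>) * norm (h x))" for x
      using exp_converges[of "norm s * \<bar>x\<bar>"] by (intro sums_mult2) (simp add: scaleR_conv_of_real field_simps)
    have normf: "norm (f n x) = (norm s * \<bar>x\<bar>) ^ n / fact n * norm (h x)" for n x
      by (simp add: f_def norm_mult norm_divide norm_power)
    have int0: "integrable lborel (\<lambda>x. exp (norm s * \<bar>x\<bar>) * norm (h x))"
      by (rule gauss_dominated_integrable_abs[OF assms])
    have partial: "(\<Sum>i<n. norm (f i x)) \<le> exp (norm s * \<bar>x\<bar>) * norm (h x)" for n x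
      unfolding normf using sum_le_suminf[OF sums_summable[OF exp_sums[of x]], of "{..<n}"]
        sums_unique[OF exp_sums[of x]] by auto
    have le: "norm (f n x) \<le> exp (norm s * \<bar>x\<bar>) * norm (h x)" for n x
      using partial[of x "Suc n"] by (simp add: order_trans[rotated] sum_nonneg)
    have [measurable]: "f n \<in> borel_measurable borel" for n unfolding f_def by measurable
    have intf: "integrable lborel (f n)" for n
      by (rule Bochner_Integration.integrable_bound[OF int0]) (use le in auto)
    have "(\<lambda>n. integral\<^sup>L lborel (f n)) sums (\<integral>x. (\<Sum>n. f n x) \<partial>lborel)"
    proof (rule sums_integral[OF intf])
      show "AE x in lborel. summable (\<lambda>n. norm (f n x))"
        using sums_summable[OF exp_sums] by (simp add: normf)
      show "summable (\<lambda>n. \<integral>x. norm (f n x) \<partial>lborel)"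
      proof (rule summableI_nonneg_bounded)
        fix n
        have "(\<Sum>i<n. \<integral>x. norm (f i x) \<partial>lborel) = (\<integral>x. (\<Sum>i<n. norm (f i x)) \<partial>lborel)"
          using intf by (subst Bochner_Integration.integral_sum) auto
        also have "\<dots> \<le> (\<integral>x. exp (norm s * \<bar>x\<bar>) * norm (h x) \<partial>lborel)"
          using intf partial by (intro integral_mono int0) auto
        finally show "(\<Sum>i<n. \<integral>x. norm (f i x) \<partial>lborel) \<le> (\<integral>x. exp (norm s * \<bar>x\<bar>) * norm (h x) \<partial>lborel)" .
      qed simp
    qed
    moreover have "(\<Sum>n. f n x) = exp (s * of_real x) * h x" for x
      using exp_converges[of "s * of_real x"] unfolding f_def
      by (intro sums_unique[symmetric] sums_mult2) (simp add: scaleR_conv_of_real field_simps)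
    moreover have "integral\<^sup>L lborel (f n) = c n * (s - 0) ^ n" for n
    proof -
      have "f n = (\<lambda>x. ((of_real x ^ n / fact n) * h x) * s ^ n)"
        by (simp add: f_def fun_eq_iff power_mult_distrib)
      then show ?thesis by (simp add: c_def del: of_real_power)
    qed
    ultimately show ?thesis by (simp add: laplace2_def)
  qed
  have "laplace2 h holomorphic_on ball 0 r" for r
    using sums by (rule power_series_holomorphic)
  then have "laplace2 h field_differentiable (at s)" for s
    using holomorphic_on_imp_differentiable_at[of "laplace2 h" "ball 0 (norm s + 1)" s] by auto
  then show ?thesis by (simp add: holomorphic_on_def)
qed

lemma laplace2_reflect: "laplace2 (\<lambda>x. h (- x)) s = laplace2 h (- s)"
  unfolding laplace2_def
  by (subst lborel_integral_real_affine[where c="-1" and t=0]) auto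

lemma laplace2_exp_mult: "laplace2 (\<lambda>x. exp (c * of_real x) * h x) s = laplace2 h (s + c)"
  unfolding laplace2_def by (simp add: distrib_right exp_add mult.assoc)

lemma laplace2_shift:
  "(\<integral>x. exp (s * of_real x) * h (x + t) \<partial>lborel) = exp (- s * of_real t) * laplace2 h s"
proof -
  have "laplace2 h s = (\<integral>x. exp (s * of_real t) * (exp (s * of_real x) * h (x + t)) \<partial>lborel)"
    unfolding laplace2_def
    by (subst lborel_integral_real_affine[where c=1 and t=t])
       (simp_all add: ring_distribs exp_add mult_ac add_ac)
  then show ?thesis by (simp add: exp_minus)
qed

text \<open>By Fubini, the inner integral over \<open>x\<close> is a shift by \<open>2 * y\<close>,
  which contributes \<open>exp (- 2 * s * y)\<close>. The step \<open>2 * y\<close> matches the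
  argument \<open>exp (2 * y)\<close> in the integral representation of the kernel.\<close>

lemma laplace2_convolution:
  assumes v: "gauss_dominated v" and h: "gauss_dominated h"
  defines "G \<equiv> (\<lambda>x. \<integral>y. v y * h (x + 2 * y) \<partial>lborel)"
  shows "integrable lborel (\<lambda>x. exp (s * of_real x) * G x)"
    and "laplace2 G s = laplace2 v (- 2 * s) * laplace2 h s"
proof -
  note [measurable] = gauss_dominated_measurable[OF v] gauss_dominated_measurable[OF h]
  let ?f = "\<lambda>y x. v y * (exp (s * of_real x) * h (x + 2 * y))"
  have int_x: "integrable lborel (\<lambda>x. exp (s * of_real x) * h (x + t))" for t
  proof -
    have "integrable lborel (\<lambda>x. exp (- s * of_real t) * (exp (s * of_real (t + 1 * x)) * h (t + 1 * x)))"
      by (intro integrable_mult_right lborel_integrable_real_affine gauss_dominated_integrable[OF h]) auto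
    then show ?thesis
      by (simp add: distrib_left exp_add[symmetric] mult.assoc[symmetric] add.commute)
  qed
  \<comment> \<open>Complex-valued, so that \<open>laplace2_shift\<close> also computes the
    integrals of norms that Fubini requires.\<close>
  let ?N = "\<lambda>x. complex_of_real (norm (h x))"
  have norm_x: "(\<integral>x. norm (exp (s * of_real x) * h (x + t)) \<partial>lborel) = exp (- Re s * t) * Re (laplace2 ?N (Re s))" for t
  proof -
    have "(\<integral>x. norm (exp (s * of_real x) * h (x + t)) \<partial>lborel) =
       Re (\<integral>x. exp (of_real (Re s) * of_real x) * ?N (x + t) \<partial>lborel)"
    proof -
      have "(\<lambda>x. exp (of_real (Re s) * of_real x) * ?N (x + t)) =
          (\<lambda>x. complex_of_real (norm (exp (s * of_real x) * h (x + t))))"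
        by (simp add: norm_mult exp_of_real flip: of_real_mult)
      then show ?thesis by (simp only: integral_complex_of_real Re_complex_of_real)
    qed
    also have "\<dots> = Re (exp (- of_real (Re s) * of_real t) * laplace2 ?N (Re s))"
      by (subst laplace2_shift) (rule refl)
    also have "exp (- of_real (Re s) * of_real t) = complex_of_real (exp (- Re s * t))"
      by (simp add: exp_of_real flip: of_real_mult of_real_minus)
    finally show ?thesis by simp
  qed
  have "integrable (lborel \<Otimes>\<^sub>M lborel) (\<lambda>(y, x). ?f y x)"
  proof (rule lborel_pair.Fubini_integrable)
    have "integrable lborel (\<lambda>y. norm (exp (of_real (- 2 * Re s) * of_real y) * v y) * Re (laplace2 ?N (Re s)))"
      by (intro integrable_mult_left integrable_norm gauss_dominated_integrable[OF v])
    then show "integrable lborel (\<lambda>y. \<integral>x. norm ((\<lambda>(y, x). ?f y x) (y, x)) \<partial>lborel)"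
      by (subst prod.case, subst norm_mult, subst integral_mult_right_zero, subst norm_x) (simp add: norm_mult mult_ac)
  qed (use int_x in \<open>auto intro!: integrable_mult_right\<close>)
  then have int2: "integrable (lborel \<Otimes>\<^sub>M lborel) (\<lambda>(x, y). ?f y x)"
    by (subst (asm) lborel_pair.integrable_product_swap_iff[symmetric]) (simp add: case_prod_unfold)
  have G: "(\<integral>y. ?f y x \<partial>lborel) = exp (s * of_real x) * G x" for x
  proof -
    have "(\<integral>y. ?f y x \<partial>lborel) = (\<integral>y. exp (s * of_real x) * (v y * h (x + 2 * y)) \<partial>lborel)"
      by (simp add: mult_ac)
    then show ?thesis by (simp add: G_def)
  qed
  show "integrable lborel (\<lambda>x. exp (s * of_real x) * G x)"
    using lborel_pair.integrable_fst'[OF int2] by (simp add: G)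
  have "laplace2 G s = (\<integral>x. \<integral>y. ?f y x \<partial>lborel \<partial>lborel)"
    by (simp add: laplace2_def G)
  also have "\<dots> = (\<integral>y. \<integral>x. ?f y x \<partial>lborel \<partial>lborel)"
    using lborel_pair.Fubini_integral[OF int2] by simp
  also have "\<dots> = (\<integral>y. (exp (- 2 * s * of_real y) * v y) * laplace2 h s \<partial>lborel)"
    by (simp add: laplace2_shift mult_ac)
  also have "\<dots> = laplace2 v (- 2 * s) * laplace2 h s"
    unfolding laplace2_def[of v] by (rule integral_mult_left_zero)
  finally show "laplace2 G s = laplace2 v (- 2 * s) * laplace2 h s" .
qed

section \<open>Substitution in Bochner integrals over the line\<close>

text \<open>The substitution rule for absolutely integrable functions and the gauge integral is
  carried over to \<open>lborel\<close>; Borel measurability makes the notions of integrability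
  agree. It serves the Gaussian substitution below and \<open>\<delta> = exp x\<close>.\<close>

lemma lborel_change_of_variables:
  fixes h :: "real \<Rightarrow> 'a :: euclidean_space" and g g' :: "real \<Rightarrow> real"
  assumes [measurable]: "h \<in> borel_measurable borel" "g' \<in> borel_measurable borel" "S \<in> sets borel"
    and der: "\<And>x. (g has_field_derivative g' x) (at x)" and pos: "\<And>x. g' x \<ge> 0"
    and inj: "inj g" and S: "range g = S"
  shows "set_integrable lborel S h \<longleftrightarrow> integrable lborel (\<lambda>x. g' x *\<^sub>R h (g x))" (is ?int)
    and "(LINT x:S|lborel. h x) = (\<integral>x. g' x *\<^sub>R h (g x) \<partial>lborel)" (is ?eq)
proof -
  let ?G = "\<lambda>x. g' x *\<^sub>R h (g x)"
  have [measurable]: "g \<in> borel_measurable borel"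
    using der by (intro borel_measurable_continuous_onI) (meson DERIV_continuous continuous_at_imp_continuous_on)
  have G: "(\<lambda>x. \<bar>g' x\<bar> *\<^sub>R h (g x)) = ?G"
    using pos by simp
  have lebesgue: "set_integrable lebesgue UNIV ?G \<longleftrightarrow> integrable lborel ?G"
      "set_integrable lebesgue S h \<longleftrightarrow> set_integrable lborel S h"
    by (simp_all add: set_integrable_def integrable_completion)
  have cov: "set_integrable lebesgue UNIV ?G \<and> integral UNIV ?G = b \<longleftrightarrow>
      set_integrable lebesgue S h \<and> integral S h = b" for b
    using has_absolute_integral_change_of_variables_real[of UNIV g g' h b] der inj S by (simp add: G)
  then show ?int unfolding lebesgue by blast
  show ?eq
  proof (cases "set_integrable lborel S h")
    case True
    then have "integrable lborel ?G" using \<open>?int\<close> by blast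
    then have "integral UNIV ?G = (\<integral>x. ?G x \<partial>lborel)"
      using set_borel_integral_eq_integral(2)[of UNIV ?G]
      by (simp add: set_lebesgue_integral_def set_integrable_def)
    then show ?thesis
      using cov[of "integral S h"] True set_borel_integral_eq_integral(2)[OF True] by (simp add: lebesgue)
  next
    \<comment> \<open>Without integrability both sides take the default value 0.\<close>
    case False
    then show ?thesis
      using \<open>?int\<close> by (simp add: set_integrable_def set_lebesgue_integral_def not_integrable_integral_eq)
  qed
qed

subsection \<open>The deformation kernel\<close>

text \<open>The nonnegative form fits both the majorant of the profile and the Tonelli computation
  for the kernel.\<close>

lemma Gamma_scaled_nn_integral:
  fixes k \<beta> :: real
  assumes "k > 0" "\<beta> > 0"
  shows "(\<integral>\<^sup>+u. ennreal (indicator {0<..} u * (u powr (k - 1) * exp (- \<beta> * u))) \<partial>lborel)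
       = ennreal (Gamma k / \<beta> powr k)"
proof -
  have "ennreal (Gamma k) = (\<integral>\<^sup>+t. ennreal (indicator {0..} t * t powr (k - 1) / exp t) \<partial>lborel)"
    by (rule Gamma_conv_nn_integral_real[OF assms(1)])
  also have "\<dots> = ennreal \<beta> * (\<integral>\<^sup>+u. ennreal (indicator {0..} (0 + \<beta> * u) * (0 + \<beta> * u) powr (k - 1) / exp (0 + \<beta> * u)) \<partial>lborel)"
    using assms by (subst nn_integral_real_affine[where c=\<beta> and t=0]) auto
  \<comment> \<open>The closed and open half-lines differ only at \<open>u = 0\<close>, where
    \<open>0 powr (k - 1) = 0\<close> by convention.\<close>
  also have "(\<lambda>u. ennreal (indicator {0..} (0 + \<beta> * u) * (0 + \<beta> * u) powr (k - 1) / exp (0 + \<beta> * u)))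
     = (\<lambda>u. ennreal (\<beta> powr (k - 1)) * ennreal (indicator {0<..} u * (u powr (k - 1) * exp (- \<beta> * u))))"
    using assms
    by (auto simp: fun_eq_iff indicator_def zero_le_mult_iff powr_mult exp_minus divide_inverse ennreal_mult[symmetric])
  also have "ennreal \<beta> * (\<integral>\<^sup>+u. \<dots> u \<partial>lborel)
      = ennreal (\<beta> powr k) * (\<integral>\<^sup>+u. ennreal (indicator {0<..} u * (u powr (k - 1) * exp (- \<beta> * u))) \<partial>lborel)"
    using assms by (subst nn_integral_cmult) (auto simp: mult.assoc[symmetric] ennreal_mult[symmetric] powr_diff)
  finally have *: "ennreal (\<beta> powr k) * (\<integral>\<^sup>+u. ennreal (indicator {0<..} u * (u powr (k - 1) * exp (- \<beta> * u))) \<partial>lborel) = ennreal (Gamma k)"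
    by simp
  then have "ennreal (1 / \<beta> powr k) * (ennreal (\<beta> powr k) * (\<integral>\<^sup>+u. ennreal (indicator {0<..} u * (u powr (k - 1) * exp (- \<beta> * u))) \<partial>lborel))
     = ennreal (1 / \<beta> powr k) * ennreal (Gamma k)"
    by (rule arg_cong)
  then show ?thesis
    using assms by (simp add: mult.assoc[symmetric] ennreal_mult[symmetric] Gamma_real_nonneg)
qed

definition tt_profile_integrand :: "real \<Rightarrow> real \<Rightarrow> real \<Rightarrow> real \<Rightarrow> real" where
  "tt_profile_integrand \<alpha> k p u =
     indicator {0<..} u * (u powr (k - 1) * (u + p) * exp (- (u + p)\<^sup>2 / (4 * \<alpha>)))"

text \<open>This is the \<phi> of the overview before normalization. Putting
  \<open>t = u + p\<close> shows it to be \<open>Gamma k\<close> times the Weyl fractional integral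
  of order \<open>k\<close> of \<open>t * exp (- t\<^sup>2 / (4 * \<alpha>))\<close>.\<close>

definition tt_profile :: "real \<Rightarrow> real \<Rightarrow> real \<Rightarrow> real" where
  "tt_profile \<alpha> k p = (\<integral>u. tt_profile_integrand \<alpha> k p u \<partial>lborel)"

lemma tt_profile_integrand_measurable [measurable]:
  "case_prod (tt_profile_integrand \<alpha> k) \<in> borel_measurable (borel \<Otimes>\<^sub>M borel)"
  "tt_profile_integrand \<alpha> k p \<in> borel_measurable borel"
  unfolding tt_profile_integrand_def[abs_def] by measurable

lemma tt_profile_measurable [measurable]: "tt_profile \<alpha> k \<in> borel_measurable borel"
  unfolding tt_profile_def[abs_def] by measurable

lemma tt_profile_integrand_nonneg: "p \<ge> 0 \<Longrightarrow> tt_profile_integrand \<alpha> k p u \<ge> 0"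
  by (simp add: tt_profile_integrand_def indicator_def)

text \<open>The Gaussian in \<open>t = u + p\<close> is split into two equal factors. One absorbs
  the linear factor \<open>t\<close>; the other, by \<open>t\<^sup>2 \<ge> p\<^sup>2 + 4 * u\<close>
  for \<open>p \<ge> 2\<close>, yields decay in \<open>p\<close> times an exponential in
  \<open>u\<close> that a Gamma integral evaluates. The arguments \<open>2 * cosh y\<close> satisfy
  \<open>p \<ge> 2\<close>.\<close>

lemma tt_profile_bound:
  fixes \<alpha> k p :: real
  assumes "\<alpha> > 0" "k > 0" "p \<ge> 2"
  shows "integrable lborel (tt_profile_integrand \<alpha> k p)"
    and "tt_profile \<alpha> k p \<le> exp (4 * \<alpha>) * Gamma k * (2 * \<alpha>) powr k * exp (- p\<^sup>2 / (8 * \<alpha>))"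
proof -
  define E where "E = exp (4 * \<alpha>) * exp (- p\<^sup>2 / (8 * \<alpha>))"
  let ?g = "\<lambda>u. indicator {0<..} u * (u powr (k - 1) * exp (- (1 / (2 * \<alpha>)) * u))"
  have g: "integrable lborel ?g \<and> integral\<^sup>L lborel ?g = Gamma k / (1 / (2 * \<alpha>)) powr k"
    using Gamma_scaled_nn_integral[of k "1 / (2 * \<alpha>)"] assms
    by (intro nn_integral_eq_integrable[THEN iffD1]) (auto simp: Gamma_real_nonneg)
  have le: "tt_profile_integrand \<alpha> k p u \<le> E * ?g u" for u
  proof (cases "u > 0")
    case True
    define t where "t = u + p"
    have t: "t > 0" "p\<^sup>2 + 4 * u \<le> t\<^sup>2"
    proof -
      show "t > 0" using True assms by (simp add: t_def)
      have "2 * u \<le> p * u" using True assms by (intro mult_right_mono) auto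
      then show "p\<^sup>2 + 4 * u \<le> t\<^sup>2" proof -
        assume le: "2 * u \<le> p * u"
        have "t\<^sup>2 = u\<^sup>2 + p\<^sup>2 + 2 * (p * u)" by (simp add: t_def power2_sum)
        then show ?thesis using le zero_le_power2[of u] by linarith
      qed
    qed
    have "t * exp (- (1 / (8 * \<alpha>)) * t\<^sup>2) \<le> exp (1 * \<bar>t\<bar>) * exp (- (1 / (8 * \<alpha>)) * t\<^sup>2)"
    proof (rule mult_right_mono)
      have "1 + t \<le> exp t" by (rule exp_ge_add_one_self)
      then have "t \<le> exp t" by linarith
      then show "t \<le> exp (1 * \<bar>t\<bar>)" using t(1) by simp
    qed simp
    also have "\<dots> \<le> exp (1\<^sup>2 / (2 * (1 / (8 * \<alpha>)))) * exp (- (1 / (8 * \<alpha>) / 2) * t\<^sup>2)"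
      by (rule gaussian_times_exp_abs_le) (use assms in auto)
    also have "\<dots> \<le> exp (4 * \<alpha>) * 1"
      using assms by (intro mult_mono) auto
    finally have 1: "t * exp (- (1 / (8 * \<alpha>)) * t\<^sup>2) \<le> exp (4 * \<alpha>)" by simp
    have "- t\<^sup>2 / (8 * \<alpha>) \<le> - p\<^sup>2 / (8 * \<alpha>) + - (1 / (2 * \<alpha>)) * u"
      using t assms by (simp add: field_simps)
    then have 2: "exp (- t\<^sup>2 / (8 * \<alpha>)) \<le> exp (- p\<^sup>2 / (8 * \<alpha>)) * exp (- (1 / (2 * \<alpha>)) * u)"
      by (simp add: exp_add[symmetric])
    have "exp (- t\<^sup>2 / (4 * \<alpha>)) = exp (- (1 / (8 * \<alpha>)) * t\<^sup>2) * exp (- t\<^sup>2 / (8 * \<alpha>))"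
      using assms by (simp add: exp_add[symmetric] field_simps)
    then have "t * exp (- t\<^sup>2 / (4 * \<alpha>)) = (t * exp (- (1 / (8 * \<alpha>)) * t\<^sup>2)) * exp (- t\<^sup>2 / (8 * \<alpha>))"
      by simp
    also have "\<dots> \<le> exp (4 * \<alpha>) * (exp (- p\<^sup>2 / (8 * \<alpha>)) * exp (- (1 / (2 * \<alpha>)) * u))"
      using 1 2 t by (intro mult_mono) auto
    finally have "u powr (k - 1) * (t * exp (- t\<^sup>2 / (4 * \<alpha>))) \<le> u powr (k - 1) * \<dots>"
      by (intro mult_left_mono) auto
    then show ?thesis using True by (simp add: tt_profile_integrand_def t_def E_def mult_ac)
  qed (simp add: tt_profile_integrand_def)
  have intE: "integrable lborel (\<lambda>u. E * ?g u)" using g by (intro integrable_mult_right) auto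
  show int: "integrable lborel (tt_profile_integrand \<alpha> k p)"
  proof (rule Bochner_Integration.integrable_bound[OF intE])
    show "AE u in lborel. norm (tt_profile_integrand \<alpha> k p u) \<le> norm (E * ?g u)"
      using le tt_profile_integrand_nonneg[of p \<alpha> k] assms(3)
      by (intro always_eventually allI) (smt (verit) real_norm_def)
  qed measurable
  have "tt_profile \<alpha> k p \<le> (\<integral>u. E * ?g u \<partial>lborel)"
    unfolding tt_profile_def by (intro integral_mono int intE le)
  also have "\<dots> = E * (Gamma k / (1 / (2 * \<alpha>)) powr k)"
    using g by (subst integral_mult_right_zero) simp
  also have "\<dots> = exp (4 * \<alpha>) * Gamma k * (2 * \<alpha>) powr k * exp (- p\<^sup>2 / (8 * \<alpha>))"
    using assms by (simp add: E_def powr_divide field_simps)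
  finally show "tt_profile \<alpha> k p \<le> exp (4 * \<alpha>) * Gamma k * (2 * \<alpha>) powr k * exp (- p\<^sup>2 / (8 * \<alpha>))" .
qed

lemma tt_profile_nonneg: "p \<ge> 0 \<Longrightarrow> tt_profile \<alpha> k p \<ge> 0"
  unfolding tt_profile_def by (intro integral_nonneg_AE) (simp add: tt_profile_integrand_nonneg)

text \<open>
  The substitution \<open>z = w exp y - b exp (- y)\<close> evaluates the integral with weight \<open>w exp y + b exp (- y)\<close>; the
  reflection \<open>y \<mapsto> ln (b / w) - y\<close> swaps its two halves, so each of them is half of the total.
\<close>

lemma Cauchy_Schloemilch_gaussian:
  fixes \<alpha> w b :: real
  assumes "\<alpha> > 0" "w > 0" "b > 0"
  defines "E \<equiv> (\<lambda>y. exp (- (w * exp y - b * exp (- y))\<^sup>2 / (4 * \<alpha>)))"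
  shows "has_bochner_integral lborel (\<lambda>y. (exp y + b * exp (- y)) * E y) (sqrt (pi * \<alpha>) * ((1 + w) / w))"
proof -
  define g where "g y = w * exp y - b * exp (- y)" for y
  define g' where "g' y = w * exp y + b * exp (- y)" for y
  define h where "h z = exp (- (1 / (4 * \<alpha>)) * z\<^sup>2)" for z
  have [measurable]: "h \<in> borel_measurable borel" "g' \<in> borel_measurable borel" "E \<in> borel_measurable borel"
    unfolding h_def g'_def E_def by measurable
  have hint: "integrable lborel h" "integral\<^sup>L lborel h = sqrt (4 * pi * \<alpha>)"
    using gaussian_has_bochner_integral[of "1 / (4 * \<alpha>)"] assms(1)
    by (auto simp: has_bochner_integral_iff h_def[abs_def] mult_ac)
  have gder: "(g has_field_derivative g' y) (at y)" for y
    unfolding g_def g'_def by (auto intro!: derivative_eq_intros)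
  have g'pos: "g' y > 0" for y unfolding g'_def using assms by (intro add_pos_pos) auto
  have "strict_mono g"
    using gder g'pos by (metis DERIV_pos_imp_increasing strict_monoI)
  then have inj: "inj g" by (rule strict_mono_imp_inj_on)
  have surj: "range g = UNIV"
  proof (intro equalityI subset_UNIV subsetI)
    fix z :: real
    \<comment> \<open>The equation \<open>g y = z\<close> is quadratic in \<open>exp y\<close>, and
      \<open>t\<close> is its positive root.\<close>
    define t where "t = (z + sqrt (z\<^sup>2 + 4 * w * b)) / (2 * w)"
    have "\<bar>z\<bar> < sqrt (z\<^sup>2 + 4 * w * b)" using assms by (intro real_less_rsqrt) auto
    then have t: "t > 0" using assms by (simp add: t_def)
    have "(2 * w * t - z)\<^sup>2 = z\<^sup>2 + 4 * w * b" using assms by (simp add: t_def)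
    then have "4 * w * (w * t\<^sup>2 - z * t - b) = 0" by (simp add: power2_eq_square algebra_simps)
    then have "w * t\<^sup>2 - z * t - b = 0" using assms by simp
    then have "g (ln t) = z" using t
      by (simp add: g_def exp_minus field_simps power2_eq_square)
    then show "z \<in> range g" by blast
  qed
  note cov = lborel_change_of_variables[of h g' UNIV g]
  have E: "E y = h (g y)" for y by (simp add: E_def h_def g_def)
  have int': "integrable lborel (\<lambda>y. g' y * E y)" "(\<integral>y. g' y * E y \<partial>lborel) = sqrt (4 * pi * \<alpha>)"
    using cov gder g'pos inj surj hint
    by (simp_all add: set_integrable_def set_lebesgue_integral_def E less_imp_le)
  define P where "P y = w * exp y * E y" for y
  define Q where "Q y = b * exp (- y) * E y" for y
  have PQ: "P y + Q y = g' y * E y" for y by (simp add: P_def Q_def g'_def algebra_simps)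
  have nonneg: "P y \<ge> 0" "Q y \<ge> 0" for y using assms by (auto simp: P_def Q_def E_def)
  have [measurable]: "P \<in> borel_measurable borel" "Q \<in> borel_measurable borel"
    unfolding P_def Q_def by measurable
  have "norm (P y) \<le> norm (g' y * E y)" "norm (Q y) \<le> norm (g' y * E y)" for y
    using nonneg[of y] PQ[of y] by auto
  then have intP: "integrable lborel P" and intQ: "integrable lborel Q"
    by (auto intro!: Bochner_Integration.integrable_bound[OF int'(1)] simp del: real_norm_def)
  have refl: "P (ln (b / w) + (-1) * y) = Q y" for y
  proof -
    have "w * exp (ln (b / w) + - 1 * y) = b * exp (- y)" "b * exp (- (ln (b / w) + -1 * y)) = w * exp y"
      using assms by (simp_all add: exp_add exp_minus exp_diff field_simps)
    then show ?thesis by (simp add: P_def Q_def E_def power2_commute)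
  qed
  have eq: "integral\<^sup>L lborel P = integral\<^sup>L lborel Q"
    by (subst lborel_integral_real_affine[where c="-1" and t="ln (b / w)"]) (simp_all only: refl, simp)
  have "integral\<^sup>L lborel P + integral\<^sup>L lborel Q = sqrt (4 * pi * \<alpha>)"
    using int'(2) intP intQ by (simp add: PQ[symmetric])
  also have "\<dots> = 2 * sqrt (pi * \<alpha>)" by (simp add: real_sqrt_mult)
  finally have PQ': "integral\<^sup>L lborel P = sqrt (pi * \<alpha>)" "integral\<^sup>L lborel Q = sqrt (pi * \<alpha>)"
    using eq by auto
  \<comment> \<open>The substitution carries the weight \<open>w * exp y + b * exp (- y)\<close>;
    dividing its first half by \<open>w\<close> produces the weight claimed.\<close>
  have "has_bochner_integral lborel (\<lambda>y. P y / w + Q y) (sqrt (pi * \<alpha>) / w + sqrt (pi * \<alpha>))"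
    using intP intQ PQ'
    by (intro has_bochner_integral_add has_bochner_integral_divide_zero) (auto simp: has_bochner_integral_iff)
  also have "(\<lambda>y. P y / w + Q y) = (\<lambda>y. (exp y + b * exp (- y)) * E y)"
    using assms by (simp add: P_def Q_def fun_eq_iff field_simps)
  finally show ?thesis using assms by (simp add: field_simps)
qed

text \<open>Substituting \<open>u = exp (- y) * v\<close> turns \<open>u + 2 * cosh y\<close> into
  \<open>exp y + (1 + v) * exp (- y)\<close>, and the resulting \<open>exp (- k * y)\<close> cancels
  the prefactor. For fixed \<open>v\<close> the weight now has the shape of
  \<open>Cauchy_Schloemilch_gaussian\<close> with \<open>b = 1 + v\<close>.\<close>

lemma tt_profile_scaled:
  fixes \<alpha> k y :: real
  assumes "\<alpha> > 0" "k > 0"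
  shows "ennreal (exp (k * y) * tt_profile \<alpha> k (2 * cosh y)) =
    (\<integral>\<^sup>+v. ennreal (indicator {0<..} v * (v powr (k - 1) * (exp y + (1 + v) * exp (- y))
        * exp (- (exp y + (1 + v) * exp (- y))\<^sup>2 / (4 * \<alpha>)))) \<partial>lborel)"
proof -
  have p: "2 * cosh y \<ge> 2" using cosh_real_ge_1[of y] by simp
  have "ennreal (tt_profile \<alpha> k (2 * cosh y)) = (\<integral>\<^sup>+u. ennreal (tt_profile_integrand \<alpha> k (2 * cosh y) u) \<partial>lborel)"
    unfolding tt_profile_def
    using tt_profile_bound(1)[OF assms p] tt_profile_integrand_nonneg p
    by (intro nn_integral_eq_integral[symmetric]) auto
  also have "\<dots> = ennreal (exp (- y)) * (\<integral>\<^sup>+v. ennreal (tt_profile_integrand \<alpha> k (2 * cosh y) (0 + exp (- y) * v)) \<partial>lborel)"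
    by (subst nn_integral_real_affine[where c="exp (- y)" and t=0]) auto
  finally have "ennreal (exp (k * y) * tt_profile \<alpha> k (2 * cosh y)) = ennreal (exp (k * y - y)) *
     (\<integral>\<^sup>+v. ennreal (tt_profile_integrand \<alpha> k (2 * cosh y) (exp (- y) * v)) \<partial>lborel)"
    by (simp add: ennreal_mult' mult.assoc[symmetric]) (simp add: ennreal_mult'[symmetric] exp_add[symmetric])
  also have "\<dots> = (\<integral>\<^sup>+v. ennreal (exp (k * y - y) * tt_profile_integrand \<alpha> k (2 * cosh y) (exp (- y) * v)) \<partial>lborel)"
    by (subst nn_integral_cmult[symmetric]) (auto simp: ennreal_mult')
  also have "(\<lambda>v. exp (k * y - y) * tt_profile_integrand \<alpha> k (2 * cosh y) (exp (- y) * v)) =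
     (\<lambda>v. indicator {0<..} v * (v powr (k - 1) * (exp y + (1 + v) * exp (- y))
        * exp (- (exp y + (1 + v) * exp (- y))\<^sup>2 / (4 * \<alpha>))))"
  proof
    fix v
    have "exp (- y) * v + 2 * cosh y = exp y + (1 + v) * exp (- y)"
      by (simp add: cosh_def algebra_simps)
    moreover have "exp (k * y - y) * (exp (- y) * v) powr (k - 1) = v powr (k - 1)" if "v > 0"
    proof -
      have "(exp (- y) * v) powr (k - 1) = exp (- (k * y - y)) * v powr (k - 1)"
        using that by (simp add: powr_mult) (simp add: powr_def algebra_simps)
      moreover have "exp (k * y - y) * exp (- (k * y - y)) = 1" by (simp flip: exp_add)
      ultimately show ?thesis by (simp only: mult.assoc[symmetric] mult_1)
    qed
    moreover have "indicator {0<..} (exp (- y) * v) = (indicator {0<..} v :: real)"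
      by (simp add: indicator_def zero_less_mult_iff)
    ultimately show "exp (k * y - y) * tt_profile_integrand \<alpha> k (2 * cosh y) (exp (- y) * v) =
      indicator {0<..} v * (v powr (k - 1) * (exp y + (1 + v) * exp (- y))
        * exp (- (exp y + (1 + v) * exp (- y))\<^sup>2 / (4 * \<alpha>)))"
      unfolding tt_profile_integrand_def
      by (cases "v > 0") (simp_all add: mult.assoc[symmetric])
  qed
  finally show ?thesis .
qed

text \<open>The deformation replaces the factor \<open>exp (- x)\<close> of each term, with
  \<open>x = 2 * pi * (\<Delta> + real n) * \<delta>\<close>, by this function.\<close>

definition tt_symbol :: "real \<Rightarrow> real \<Rightarrow> real \<Rightarrow> real" where
  "tt_symbol \<alpha> k x = (let w = sqrt (1 + 4 * \<alpha> * x) in (1 + w) powr (1 - k) / w * exp (- (w - 1) / (2 * \<alpha>)))"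

text \<open>Collects the constants of the Gaussian and Gamma integrals;
  \<open>exp (- 1 / \<alpha>)\<close> is the ratio of
  \<open>exp (- (1 + w) / (2 * \<alpha>))\<close> to
  \<open>exp (- (w - 1) / (2 * \<alpha>))\<close>.\<close>

definition tt_norm :: "real \<Rightarrow> real \<Rightarrow> real" where
  "tt_norm \<alpha> k = sqrt (pi * \<alpha>) * Gamma k * (2 * \<alpha>) powr k * exp (- 1 / \<alpha>)"

definition tt_kernel :: "real \<Rightarrow> real \<Rightarrow> real \<Rightarrow> real" where
  "tt_kernel \<alpha> k y = exp (k * y) * tt_profile \<alpha> k (2 * cosh y) / tt_norm \<alpha> k"

lemma tt_norm_pos: "\<alpha> > 0 \<Longrightarrow> k > 0 \<Longrightarrow> tt_norm \<alpha> k > 0"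
  by (simp add: tt_norm_def Gamma_real_pos)

lemma tt_kernel_nonneg: "\<alpha> > 0 \<Longrightarrow> k > 0 \<Longrightarrow> tt_kernel \<alpha> k y \<ge> 0"
  unfolding tt_kernel_def using tt_norm_pos[of \<alpha> k]
  by (intro divide_nonneg_pos mult_nonneg_nonneg tt_profile_nonneg) auto

lemma tt_kernel_measurable [measurable]: "tt_kernel \<alpha> k \<in> borel_measurable borel"
  unfolding tt_kernel_def[abs_def] cosh_def by measurable

text \<open>
  Carrying out the \<open>y\<close>-integration first, for fixed \<open>v\<close>, leaves a Gamma integral in \<open>v\<close>.
\<close>

lemma tt_kernel_laplace:
  fixes \<alpha> k x :: real
  assumes "\<alpha> > 0" "k > 0" "x \<ge> 0"
  shows "has_bochner_integral lborel (\<lambda>y. exp (- x * exp (2 * y)) * tt_kernel \<alpha> k y) (tt_symbol \<alpha> k x)"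
proof -
  define w where "w = sqrt (1 + 4 * \<alpha> * x)"
  have w: "w > 0" "w\<^sup>2 = 1 + 4 * \<alpha> * x"
    using assms by (auto simp: w_def add_pos_nonneg)
  define f where "f v y = indicator {0<..} v * (v powr (k - 1) * ((exp y + (1 + v) * exp (- y))
        * exp (- x * exp (2 * y) - (exp y + (1 + v) * exp (- y))\<^sup>2 / (4 * \<alpha>))))" for v y :: real
  have [measurable]: "case_prod f \<in> borel_measurable (borel \<Otimes>\<^sub>M borel)"
    unfolding f_def by measurable
  have f0: "f v y \<ge> 0" for v y by (auto simp: f_def indicator_def)
  define K where "K = sqrt (pi * \<alpha>) * ((1 + w) / w) * exp (- (1 + w) / (2 * \<alpha>))"
  have K0: "K \<ge> 0" using w(1) assms(1) by (simp add: K_def)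
  have inner: "(\<integral>\<^sup>+y. ennreal (f v y) \<partial>lborel) = ennreal (K
      * (indicator {0<..} v * (v powr (k - 1) * exp (- ((1 + w) / (2 * \<alpha>)) * v))))" for v
  proof (cases "v > 0")
    case True
    define b where "b = 1 + v"
    have b: "b > 0" using True by (simp add: b_def)
    let ?E = "\<lambda>y. exp (- (w * exp y - b * exp (- y))\<^sup>2 / (4 * \<alpha>))"
    let ?c = "v powr (k - 1) * exp (- b * (1 + w) / (2 * \<alpha>))"
    have "f v y = ?c * ((exp y + b * exp (- y)) * ?E y)" for y
    proof -
      \<comment> \<open>Since \<open>4 * \<alpha> * x = w\<^sup>2 - 1\<close>, the coefficient of
        \<open>exp (2 * y)\<close> rises from 1 to \<open>w\<^sup>2\<close>; the cross terms are
        constant and leave \<open>2 * b * (1 + w)\<close>.\<close>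
      have "(4 * \<alpha> * x) * exp (2 * y) + (exp y + b * exp (- y))\<^sup>2 = (w * exp y - b * exp (- y))\<^sup>2 + 2 * b * (1 + w)"
      proof -
        have "exp (2 * y) = exp y ^ 2" by (simp add: exp_double)
        moreover have "exp y * exp (- y) = 1" by (simp add: exp_minus)
        moreover have "4 * \<alpha> * x = w\<^sup>2 - 1" using w by simp
        ultimately show ?thesis by algebra
      qed
      then have "- x * exp (2 * y) - (exp y + b * exp (- y))\<^sup>2 / (4 * \<alpha>)
        = - b * (1 + w) / (2 * \<alpha>) + - (w * exp y - b * exp (- y))\<^sup>2 / (4 * \<alpha>)"
      proof -
        assume *: "(4 * \<alpha> * x) * exp (2 * y) + (exp y + b * exp (- y))\<^sup>2 = (w * exp y - b * exp (- y))\<^sup>2 + 2 * b * (1 + w)"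
        have "x * exp (2 * y) = ((4 * \<alpha> * x) * exp (2 * y)) / (4 * \<alpha>)" using assms by simp
        also have "(4 * \<alpha> * x) * exp (2 * y) = (w * exp y - b * exp (- y))\<^sup>2 + 2 * b * (1 + w) - (exp y + b * exp (- y))\<^sup>2"
          using * by linarith
        finally show ?thesis by (simp add: add_divide_distrib diff_divide_distrib)
      qed
      then have "exp (- x * exp (2 * y) - (exp y + b * exp (- y))\<^sup>2 / (4 * \<alpha>)) = exp (- b * (1 + w) / (2 * \<alpha>)) * ?E y"
        by (simp only: exp_add)
      then show ?thesis using True by (simp only: f_def b_def[symmetric]) (simp add: mult_ac)
    qed
    then have "f v = (\<lambda>y. ?c * ((exp y + b * exp (- y)) * ?E y))" by (rule ext)
    then have "has_bochner_integral lborel (f v) (?c * (sqrt (pi * \<alpha>) * ((1 + w) / w)))"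
      using has_bochner_integral_mult_right[OF Cauchy_Schloemilch_gaussian[OF assms(1) w(1) b], of ?c]
      by (simp only:)
    then have "(\<integral>\<^sup>+y. ennreal (f v y) \<partial>lborel) = ennreal (?c * (sqrt (pi * \<alpha>) * ((1 + w) / w)))"
      using f0 by (simp add: has_bochner_integral_iff nn_integral_eq_integral)
    moreover have "exp (- b * (1 + w) / (2 * \<alpha>)) = exp (- (1 + w) / (2 * \<alpha>)) * exp (- ((1 + w) / (2 * \<alpha>)) * v)"
      unfolding exp_add[symmetric] using assms(1) by (simp add: b_def field_simps)
    ultimately show ?thesis using True by (simp add: K_def mult_ac)
  next
    case False
    then have "f v y = 0" for y by (simp add: f_def)
    then show ?thesis using False by simp
  qed
  have "(\<integral>\<^sup>+y. ennreal (exp (- x * exp (2 * y)) * (exp (k * y) * tt_profile \<alpha> k (2 * cosh y))) \<partial>lborel)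
     = (\<integral>\<^sup>+y. \<integral>\<^sup>+v. ennreal (f v y) \<partial>lborel \<partial>lborel)"
  proof (rule nn_integral_cong)
    fix y
    let ?q = "\<lambda>v. indicator {0<..} v * (v powr (k - 1) * (exp y + (1 + v) * exp (- y))
        * exp (- (exp y + (1 + v) * exp (- y))\<^sup>2 / (4 * \<alpha>)))"
    have f: "f v y = exp (- x * exp (2 * y)) * ?q v" for v
    proof -
      have "exp (- x * exp (2 * y) - (exp y + (1 + v) * exp (- y))\<^sup>2 / (4 * \<alpha>))
        = exp (- x * exp (2 * y)) * exp (- (exp y + (1 + v) * exp (- y))\<^sup>2 / (4 * \<alpha>))"
        unfolding exp_add[symmetric] by simp
      then show ?thesis unfolding f_def by (simp only: mult_ac)
    qed
    have "ennreal (exp (- x * exp (2 * y)) * (exp (k * y) * tt_profile \<alpha> k (2 * cosh y)))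
        = ennreal (exp (- x * exp (2 * y))) * (\<integral>\<^sup>+v. ennreal (?q v) \<partial>lborel)"
      unfolding ennreal_mult'[of "exp (- x * exp (2 * y))", OF exp_ge_zero] tt_profile_scaled[OF assms(1,2)] ..
    also have "\<dots> = (\<integral>\<^sup>+v. ennreal (exp (- x * exp (2 * y))) * ennreal (?q v) \<partial>lborel)"
      by (rule nn_integral_cmult[symmetric]) measurable
    also have "\<dots> = (\<integral>\<^sup>+v. ennreal (f v y) \<partial>lborel)"
      unfolding f ennreal_mult'[OF exp_ge_zero] ..
    finally show "ennreal (exp (- x * exp (2 * y)) * (exp (k * y) * tt_profile \<alpha> k (2 * cosh y))) = (\<integral>\<^sup>+v. ennreal (f v y) \<partial>lborel)" .
  qed
  \<comment> \<open>Tonelli: the integrand is nonnegative, so integrability can be read off from the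
    final value.\<close>
  also have "\<dots> = (\<integral>\<^sup>+v. \<integral>\<^sup>+y. ennreal (f v y) \<partial>lborel \<partial>lborel)"
    by (rule lborel_pair.Fubini') measurable
  also have "\<dots> = (\<integral>\<^sup>+v. ennreal K * ennreal (indicator {0<..} v * (v powr (k - 1) * exp (- ((1 + w) / (2 * \<alpha>)) * v))) \<partial>lborel)"
    unfolding inner ennreal_mult'[OF K0] ..
  also have "\<dots> = ennreal K * (\<integral>\<^sup>+v. ennreal (indicator {0<..} v * (v powr (k - 1) * exp (- ((1 + w) / (2 * \<alpha>)) * v))) \<partial>lborel)"
    by (rule nn_integral_cmult) measurable
  also have "\<dots> = ennreal (K * (Gamma k / ((1 + w) / (2 * \<alpha>)) powr k))"
    unfolding ennreal_mult'[OF K0] using assms w by (subst Gamma_scaled_nn_integral) auto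
  also have "K * (Gamma k / ((1 + w) / (2 * \<alpha>)) powr k) = tt_symbol \<alpha> k x * tt_norm \<alpha> k"
  proof -
    have "- (1 + w) / (2 * \<alpha>) = - (w - 1) / (2 * \<alpha>) + - 1 / \<alpha>" using assms(1) by (simp add: field_simps)
    then have e: "exp (- (1 + w) / (2 * \<alpha>)) = exp (- (w - 1) / (2 * \<alpha>)) * exp (- 1 / \<alpha>)"
      by (simp only: exp_add)
    \<comment> \<open>The Gaussian integral supplies one factor \<open>1 + w\<close>, the Gamma
      integral its inverse \<open>k\<close>-th power: this is the origin of the exponent
      \<open>1 - k\<close>.\<close>
    have p: "(1 + w) / ((1 + w) / (2 * \<alpha>)) powr k = (1 + w) powr (1 - k) * (2 * \<alpha>) powr k"
      using assms(1) w(1) by (simp add: powr_diff powr_divide)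
    have "K * (Gamma k / ((1 + w) / (2 * \<alpha>)) powr k) = sqrt (pi * \<alpha>) * Gamma k / w *
        exp (- (1 + w) / (2 * \<alpha>)) * ((1 + w) / ((1 + w) / (2 * \<alpha>)) powr k)"
      by (simp add: K_def)
    then show ?thesis
      unfolding e p by (simp add: tt_symbol_def tt_norm_def Let_def w_def[symmetric])
  qed
  finally have *: "(\<integral>\<^sup>+y. ennreal (exp (- x * exp (2 * y)) * (exp (k * y) * tt_profile \<alpha> k (2 * cosh y))) \<partial>lborel)
      = ennreal (tt_symbol \<alpha> k x * tt_norm \<alpha> k)" .
  have "has_bochner_integral lborel (\<lambda>y. exp (- x * exp (2 * y)) * (exp (k * y) * tt_profile \<alpha> k (2 * cosh y))) (tt_symbol \<alpha> k x * tt_norm \<alpha> k)"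
  proof (rule has_bochner_integral_nn_integral[OF _ _ _ *])
    show "(\<lambda>y. exp (- x * exp (2 * y)) * (exp (k * y) * tt_profile \<alpha> k (2 * cosh y))) \<in> borel_measurable lborel"
      unfolding cosh_def by measurable
    show "0 \<le> tt_symbol \<alpha> k x * tt_norm \<alpha> k"
      using tt_norm_pos[OF assms(1,2)] w(1) by (simp add: tt_symbol_def Let_def w_def[symmetric])
  qed (simp add: tt_profile_nonneg)
  from has_bochner_integral_divide_zero[OF this, of "tt_norm \<alpha> k"] show ?thesis
    using tt_norm_pos[OF assms(1,2)] by (simp add: tt_kernel_def)
qed

text \<open>The profile decays like a Gaussian in \<open>2 * cosh y\<close>, and
  \<open>\<bar>y\<bar> \<le> cosh y\<close>.\<close>

lemma tt_even_kernel_gauss_dominated: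
  assumes "\<alpha> > 0" "k > 0"
  shows "gauss_dominated (\<lambda>y. of_real (tt_profile \<alpha> k (2 * cosh y) / tt_norm \<alpha> k))"
proof (rule gauss_dominatedI)
  let ?K = "exp (4 * \<alpha>) * Gamma k * (2 * \<alpha>) powr k / tt_norm \<alpha> k"
  show "1 / (4 * \<alpha>) > 0" using assms by simp
  show "(\<lambda>y. complex_of_real (tt_profile \<alpha> k (2 * cosh y) / tt_norm \<alpha> k)) \<in> borel_measurable borel"
    unfolding cosh_def by measurable
  fix y :: real
  have p: "2 * cosh y \<ge> 2" using cosh_real_ge_1[of y] by simp
  have "2 * y\<^sup>2 \<le> (2 * cosh y)\<^sup>2"
  proof -
    have "0 \<le> ((\<bar>y\<bar> - 1)\<^sup>2 + 1) / 4" by simp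
    also have "\<dots> = (1 + \<bar>y\<bar> + \<bar>y\<bar>\<^sup>2 / 2) / 2 - \<bar>y\<bar>" by (simp add: power2_diff field_simps)
    also have "\<dots> \<le> exp \<bar>y\<bar> / 2 - \<bar>y\<bar>"
      using exp_lower_Taylor_quadratic[of "\<bar>y\<bar>"] by simp
    also have "\<dots> \<le> cosh \<bar>y\<bar> - \<bar>y\<bar>" by (simp add: cosh_def)
    finally have "\<bar>y\<bar> \<le> cosh y" by simp
    then have "y\<^sup>2 \<le> (cosh y)\<^sup>2" by (metis abs_ge_zero power2_abs power_mono)
    then show ?thesis by (simp add: power_mult_distrib) (smt (verit) zero_le_power2)
  qed
  then have "- (2 * cosh y)\<^sup>2 / (8 * \<alpha>) \<le> - (1 / (4 * \<alpha>)) * y\<^sup>2"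
    using assms by (simp add: field_simps)
  then have "exp (- (2 * cosh y)\<^sup>2 / (8 * \<alpha>)) \<le> exp (- (1 / (4 * \<alpha>)) * y\<^sup>2)" by simp
  then have "exp (4 * \<alpha>) * Gamma k * (2 * \<alpha>) powr k * exp (- (2 * cosh y)\<^sup>2 / (8 * \<alpha>)) \<le> exp (4 * \<alpha>) * Gamma k * (2 * \<alpha>) powr k * exp (- (1 / (4 * \<alpha>)) * y\<^sup>2)"
    using assms by (intro mult_left_mono) (auto simp: Gamma_real_nonneg)
  then have "tt_profile \<alpha> k (2 * cosh y) \<le> exp (4 * \<alpha>) * Gamma k * (2 * \<alpha>) powr k * exp (- (1 / (4 * \<alpha>)) * y\<^sup>2)"
    using tt_profile_bound(2)[OF assms p] by (rule order_trans[rotated])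
  then show "cmod (complex_of_real (tt_profile \<alpha> k (2 * cosh y) / tt_norm \<alpha> k)) \<le> ?K * exp (0 * \<bar>y\<bar>) * exp (- (1 / (4 * \<alpha>)) * y\<^sup>2)"
    using tt_norm_pos[OF assms] tt_profile_nonneg[of "2 * cosh y" \<alpha> k] p
    by (simp add: divide_right_mono norm_divide)
qed

subsection \<open>Growth of modular forms and of their coefficients\<close>

text \<open>For \<open>p > 0\<close> the bound is the maximum, attained at \<open>x = p / d\<close>;
  otherwise both factors are nonincreasing. The threshold \<open>1/2\<close> is the lower edge of
  the strip to which heights are reduced below.\<close>

lemma powr_times_exp_bounded:
  fixes p d :: real
  assumes "d > 0"
  obtains M where "\<And>x. x \<ge> 1/2 \<Longrightarrow> x powr p * exp (- (d * x)) \<le> M"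
proof (cases "p > 0")
  case True
  have "x powr p * exp (- (d * x)) \<le> exp (- p - p * ln (d / p))" if "x \<ge> 1/2" for x
  proof -
    have x: "x > 0" using that by simp
    then have "ln (d / p * x) \<le> d / p * x - 1"
      using assms True by (intro ln_le_minus_one) simp
    moreover have "ln (d / p * x) = ln (d / p) + ln x" using x assms True by (intro ln_mult_pos) auto
    ultimately have "ln x \<le> d / p * x - 1 - ln (d / p)" by simp
    then have "p * ln x \<le> p * (d / p * x - 1 - ln (d / p))" using True by (intro mult_left_mono) auto
    then have "p * ln x - d * x \<le> - p - p * ln (d / p)" using True by (simp add: algebra_simps)
    then have "exp (p * ln x + - (d * x)) \<le> exp (- p - p * ln (d / p))" by simp
    then show ?thesis unfolding exp_add using x by (simp add: powr_def)
  qed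
  then show ?thesis by (rule that)
next
  case False
  have "x powr p * exp (- (d * x)) \<le> (1/2) powr p * 1" if "x \<ge> 1/2" for x
    using that False assms by (intro mult_mono powr_mono2') auto
  then show ?thesis by (rule that)
qed

text \<open>Polynomial coefficient growth against the decay \<open>exp (- d * sqrt n)\<close> of
  deformed terms.\<close>

lemma summable_powr_times_exp_sqrt:
  fixes p d c :: real
  assumes "d > 0" "c > 0"
  shows "summable (\<lambda>n. (c + real n) powr p * exp (- (d * sqrt (c + real n))))"
proof -
  \<comment> \<open>In \<open>x = sqrt (c + n)\<close> the power is \<open>x powr (2 * p)\<close>;
    the spare \<open>x ^ 4\<close> dominates \<open>n\<^sup>2\<close> and allows comparison with the
    sum of inverse squares.\<close>
  obtain M where M: "\<And>x. x \<ge> 1/2 \<Longrightarrow> x powr (2 * p + 4) * exp (- (d * x)) \<le> M"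
    using powr_times_exp_bounded[OF assms(1)] by blast
  show ?thesis
  proof (rule summable_comparison_test_ev)
    show "summable (\<lambda>n. M * (1 / real n ^ 2))"
      using inverse_power_summable[of 2, where ?'a = real] by (intro summable_mult) (simp add: divide_inverse)
    show "eventually (\<lambda>n. norm ((c + real n) powr p * exp (- (d * sqrt (c + real n)))) \<le> M * (1 / real n ^ 2)) sequentially"
      using eventually_ge_at_top[of 1]
    proof eventually_elim
      case (elim n)
      define x where "x = sqrt (c + real n)"
      have x2: "c + real n = x\<^sup>2" using assms by (simp add: x_def)
      have x: "x \<ge> 1" using elim assms by (simp add: x_def)
      have "x powr (2 * p + 4) = (x\<^sup>2) powr p * x ^ 4"
        using x by (simp add: powr_add powr_powr flip: powr_numeral)
      then have "x ^ 4 * ((x\<^sup>2) powr p * exp (- (d * x))) \<le> M" using M[of x] x by (simp add: mult_ac)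
      moreover have "real n ^ 2 \<le> x ^ 4"
      proof -
        have "real n \<le> x\<^sup>2" using x2 assms by linarith
        then have "real n ^ 2 \<le> (x\<^sup>2) ^ 2" by (rule power_mono) simp
        then show ?thesis by simp
      qed
      ultimately have "real n ^ 2 * ((x\<^sup>2) powr p * exp (- (d * x))) \<le> M"
        by (smt (verit) exp_ge_zero mult_nonneg_nonneg mult_right_mono powr_ge_zero)
      then have "(x\<^sup>2) powr p * exp (- (d * x)) \<le> M * (1 / real n ^ 2)"
        using elim by (simp add: field_simps)
      then show ?case unfolding x_def[symmetric] unfolding x2 by simp
    qed
  qed
qed

section \<open>The expansion of a form in the nome\<close>

locale modular_form =
  fixes k \<Delta> :: real and a :: "nat \<Rightarrow> complex"
  assumes modular_form_data: "modular_form_data k \<Delta> a"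
begin

lemma Delta_pos: "\<Delta> > 0"
  and summable_form_term: "Re \<delta> > 0 \<Longrightarrow> summable (\<lambda>n. form_term \<Delta> a n \<delta>)"
  and form_series_inverse: "Re \<delta> > 0 \<Longrightarrow> form_series \<Delta> a (1 / \<delta>) = \<delta> powr of_real k * form_series \<Delta> a \<delta>"
  using modular_form_data by (auto simp: modular_form_data_def)

abbreviation nome :: "complex \<Rightarrow> complex" where
  "nome \<delta> \<equiv> exp (- (of_real (2 * pi) * \<delta>))"

lemma norm_nome: "norm (nome \<delta>) = exp (- (2 * pi * Re \<delta>))"
  by simp

lemma form_term_nome: "form_term \<Delta> a n \<delta> = exp (- of_real (2 * pi * \<Delta>) * \<delta>) * (a n * nome \<delta> ^ n)"
proof -
  have "- complex_of_real (2 * pi * (\<Delta> + real n)) * \<delta> = - of_real (2 * pi * \<Delta>) * \<delta> + of_nat n * - (of_real (2 * pi) * \<delta>)"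
    by (simp add: algebra_simps)
  then show ?thesis
    unfolding form_term_def by (simp only: exp_add exp_of_nat_mult mult_ac)
qed

definition q_series :: "complex fps" where "q_series = Abs_fps a"

text \<open>Every \<open>r\<close> in (0, 1) is the nome of the positive real point
  \<open>- ln r / (2 * pi)\<close>, where the series of the form converges.\<close>

lemma q_series_conv_radius: "fps_conv_radius q_series \<ge> 1"
  unfolding fps_conv_radius_def
proof (rule conv_radius_geI_ex)
  fix r :: real assume r: "0 < r" "ereal r < 1"
  define \<delta> where "\<delta> = complex_of_real (- ln r / (2 * pi))"
  have "ln r < 0" using r by simp
  then have d: "Re \<delta> > 0" by (simp add: \<delta>_def divide_neg_pos)
  have "nome \<delta> = of_real (exp (ln r))" by (simp add: \<delta>_def exp_of_real)
  then have "nome \<delta> = of_real r" using r by simp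
  then have "summable (\<lambda>n. exp (- of_real (2 * pi * \<Delta>) * \<delta>) * (a n * of_real r ^ n))"
    using summable_form_term[OF d] by (simp add: form_term_nome)
  then have "summable (\<lambda>n. fps_nth q_series n * of_real r ^ n)"
    by (simp add: q_series_def summable_cmult_iff del: summable_cmult_iff) (simp add: summable_cmult_iff)
  then show "\<exists>z. norm z = r \<and> summable (\<lambda>n. fps_nth q_series n * z ^ n)"
    using r by (intro exI[of _ "of_real r"]) simp
qed

lemma nome_in_disc: "Re \<delta> > 0 \<Longrightarrow> nome \<delta> \<in> eball 0 (fps_conv_radius q_series)"
proof -
  assume "Re \<delta> > 0"
  then have "ereal (norm (nome \<delta>)) < 1" by simp
  then have "ereal (norm (nome \<delta>)) < fps_conv_radius q_series"
    using q_series_conv_radius by (rule order_less_le_trans)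
  then show ?thesis by (simp add: in_eball_iff)
qed

lemma form_series_nome:
  assumes "Re \<delta> > 0"
  shows "form_series \<Delta> a \<delta> = exp (- of_real (2 * pi * \<Delta>) * \<delta>) * eval_fps q_series (nome \<delta>)"
proof -
  have "summable (\<lambda>n. fps_nth q_series n * nome \<delta> ^ n)"
    using nome_in_disc[OF assms] by (intro summable_fps) (simp add: in_eball_iff)
  then show ?thesis
    unfolding form_series_def form_term_nome eval_fps_def q_series_def
    by (subst suminf_mult[symmetric]) auto
qed

lemma abs_summable_form_term:
  assumes "Re \<delta> > 0"
  shows "summable (\<lambda>n. norm (form_term \<Delta> a n \<delta>))"
proof -
  have "summable (\<lambda>n. norm (fps_nth q_series n * nome \<delta> ^ n))"
    using nome_in_disc[OF assms] by (intro norm_summable_fps) (simp add: in_eball_iff)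
  then show ?thesis
    unfolding form_term_nome norm_mult[of "exp _"] by (intro summable_mult) (simp add: q_series_def)
qed

lemma holomorphic_form_series: "form_series \<Delta> a holomorphic_on {\<delta>. Re \<delta> > 0}"
proof (rule holomorphic_transform)
  have "(eval_fps q_series \<circ> nome) holomorphic_on {\<delta>. Re \<delta> > 0}"
    using nome_in_disc
    by (intro holomorphic_on_compose holomorphic_on_eval_fps) (auto intro!: holomorphic_intros)
  then show "(\<lambda>\<delta>. exp (- of_real (2 * pi * \<Delta>) * \<delta>) * (eval_fps q_series \<circ> nome) \<delta>) holomorphic_on {\<delta>. Re \<delta> > 0}"
    by (intro holomorphic_intros)
qed (simp add: form_series_nome)

text \<open>The nome has period \<i>, but \<Delta> may be any positive real, so the prefactor
  changes by a phase and only the norm is invariant.\<close>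

lemma norm_form_series_shift:
  fixes m :: int
  assumes "Re \<delta> > 0"
  shows "norm (form_series \<Delta> a (\<delta> + \<i> * of_int m)) = norm (form_series \<Delta> a \<delta>)"
proof -
  have "nome (\<delta> + \<i> * of_int m) = exp (- (of_real (2 * pi) * \<delta>) + \<i> * (of_int (- m) * (of_real pi * 2)))"
    by (simp add: algebra_simps)
  then have "nome (\<delta> + \<i> * of_int m) = nome \<delta>" by (simp only: exp_plus_2pin)
  then show ?thesis using assms by (simp add: form_series_nome norm_mult)
qed

text \<open>The half-plane \<open>Re \<delta> \<ge> x\<^sub>0\<close> is mapped by the nome into a
  compact disc inside the disc of convergence, so all the decay comes from the prefactor with
  \<Delta> > 0.\<close>

lemma form_series_decay:
  assumes "x\<^sub>0 > 0"
  obtains B where "B > 0" "\<And>\<delta>. Re \<delta> \<ge> x\<^sub>0 \<Longrightarrow> norm (form_series \<Delta> a \<delta>) \<le> B * exp (- (2 * pi * \<Delta> * Re \<delta>))"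
proof -
  have sub: "cball 0 (exp (- (2 * pi * x\<^sub>0))) \<subseteq> eball (0::complex) (fps_conv_radius q_series)"
  proof
    fix z :: complex assume "z \<in> cball 0 (exp (- (2 * pi * x\<^sub>0)))"
    then have "norm z \<le> exp (- (2 * pi * x\<^sub>0))" by simp
    also have "\<dots> < 1" using assms by simp
    finally have "ereal (norm z) < 1" by simp
    then have "ereal (norm z) < fps_conv_radius q_series"
      using q_series_conv_radius by (rule order_less_le_trans)
    then show "z \<in> eball 0 (fps_conv_radius q_series)" by (simp add: in_eball_iff)
  qed
  then have "compact (eval_fps q_series ` cball 0 (exp (- (2 * pi * x\<^sub>0))))"
    by (intro compact_continuous_image continuous_on_subset[OF continuous_on_eval_fps] compact_cball)
  then obtain B where B: "B > 0" "\<And>z. z \<in> cball 0 (exp (- (2 * pi * x\<^sub>0))) \<Longrightarrow> norm (eval_fps q_series z) \<le> B"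
    using compact_imp_bounded[THEN bounded_pos[THEN iffD1]] by (metis imageI)
  have "norm (form_series \<Delta> a \<delta>) \<le> B * exp (- (2 * pi * \<Delta> * Re \<delta>))" if "Re \<delta> \<ge> x\<^sub>0" for \<delta>
  proof -
    have "Re \<delta> > 0" using that assms by simp
    moreover have "norm (eval_fps q_series (nome \<delta>)) \<le> B"
      using that by (intro B(2)) (simp add: norm_nome)
    ultimately show ?thesis by (simp add: form_series_nome norm_mult mult.commute)
  qed
  with B(1) show ?thesis by (rule that)
qed

section \<open>Hecke's bound via an invariant height\<close>

definition invariant_height :: "complex \<Rightarrow> real" where
  "invariant_height \<delta> = Re \<delta> powr (k / 2) * norm (form_series \<Delta> a \<delta>)"

lemma invariant_height_shift:
  "Re \<delta> > 0 \<Longrightarrow> invariant_height (\<delta> + \<i> * of_int m) = invariant_height \<delta>"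
  by (simp add: invariant_height_def norm_form_series_shift)

text \<open>Inversion divides \<open>Re \<delta>\<close> by \<open>(norm \<delta>)\<^sup>2\<close>,
  so the exponent \<open>k / 2\<close> exactly offsets the modulus of
  \<open>\<delta> powr k\<close>.\<close>

lemma invariant_height_inverse:
  assumes "Re \<delta> > 0"
  shows "invariant_height (1 / \<delta>) = invariant_height \<delta>"
proof -
  have n: "norm \<delta> > 0" using assms by auto
  have Re: "Re (1 / \<delta>) = Re \<delta> / (norm \<delta>)\<^sup>2" by (simp add: Re_divide cmod_power2)
  have p: "((norm \<delta>)\<^sup>2) powr (k / 2) = norm \<delta> powr k"
    using n by (simp add: powr_powr flip: powr_numeral)
  have "norm (\<delta> powr of_real k) = norm \<delta> powr k" by (simp add: norm_powr_real_powr')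
  then show ?thesis
    using assms n unfolding invariant_height_def form_series_inverse[OF assms] Re norm_mult
    by (simp add: powr_divide p)
qed

text \<open>
  After a translation into \<open>\<bar>Im \<delta>\<bar> \<le> 1/2\<close>, the inversion at least doubles \<open>Re \<delta>\<close> as long as
  \<open>Re \<delta> < 1/2\<close>, so no fundamental domain is needed.
\<close>

lemma reduce_to_strip:
  assumes "Re \<delta> > 0"
  shows "\<exists>\<delta>'. Re \<delta>' \<ge> 1/2 \<and> \<bar>Im \<delta>'\<bar> \<le> 1/2 \<and> invariant_height \<delta>' = invariant_height \<delta>"
proof -
  \<comment> \<open>Here \<open>n\<close> bounds the number of inversions required, each one gaining
    a factor of at least 2.\<close>
  have "\<exists>\<delta>'. Re \<delta>' \<ge> 1/2 \<and> \<bar>Im \<delta>'\<bar> \<le> 1/2 \<and> invariant_height \<delta>' = invariant_height \<delta>"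
    if "Re \<delta> \<ge> (1/2) ^ Suc n" for n \<delta>
    using that
  proof (induction n arbitrary: \<delta>)
    case (0 \<delta>)
    let ?m = "- round (Im \<delta>)"
    have "\<bar>Im (\<delta> + \<i> * of_int ?m)\<bar> \<le> 1/2"
      using of_int_round_abs_le[of "Im \<delta>"] by (simp add: abs_minus_commute)
    moreover have "Re \<delta> > 0" using 0 by simp
    ultimately show ?case
      using 0 invariant_height_shift[of \<delta> ?m] by (intro exI[of _ "\<delta> + \<i> * of_int ?m"]) simp
  next
    case (Suc n \<delta>)
    define \<delta>1 where "\<delta>1 = \<delta> + \<i> * of_int (- round (Im \<delta>))"
    have Re1: "Re \<delta>1 = Re \<delta>" by (simp add: \<delta>1_def)
    have pos: "Re \<delta> > 0" using Suc.prems by (smt (verit) zero_less_power half_gt_zero_iff zero_less_one)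
    have h1: "invariant_height \<delta>1 = invariant_height \<delta>"
      unfolding \<delta>1_def by (rule invariant_height_shift[OF pos])
    have Im1: "\<bar>Im \<delta>1\<bar> \<le> 1/2"
      using of_int_round_abs_le[of "Im \<delta>"] by (simp add: \<delta>1_def abs_minus_commute)
    show ?case
    proof (cases "Re \<delta> \<ge> 1/2")
      case True
      then show ?thesis using Re1 h1 Im1 by (intro exI[of _ \<delta>1]) simp
    next
      case False
      \<comment> \<open>Both coordinates are at most \<open>1/2\<close> in modulus, so
        \<open>(norm \<delta>1)\<^sup>2 \<le> 1/2\<close>, whose inverse is the factor 2.\<close>
      have "(Re \<delta>1)\<^sup>2 \<le> (1/2)\<^sup>2" using False pos Re1 by (intro power_mono) auto
      moreover have "(Im \<delta>1)\<^sup>2 \<le> (1/2)\<^sup>2" using Im1 by (metis abs_ge_zero power2_abs power_mono)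
      ultimately have "(norm \<delta>1)\<^sup>2 \<le> 1/2" by (simp add: cmod_power2 power_divide)
      moreover have "(norm \<delta>1)\<^sup>2 > 0" using pos Re1 by auto
      ultimately have "2 * Re \<delta>1 \<le> Re \<delta>1 / (norm \<delta>1)\<^sup>2"
        using pos Re1 mult_left_mono[of "(norm \<delta>1)\<^sup>2" "1/2" "2 * Re \<delta>1"] by (simp add: le_divide_eq)
      also have "\<dots> = Re (1 / \<delta>1)" by (simp add: Re_divide cmod_power2)
      finally have "Re (1 / \<delta>1) \<ge> (1/2) ^ Suc n" using Suc.prems Re1 by simp
      from Suc.IH[OF this] show ?thesis
        using invariant_height_inverse[of \<delta>1] pos Re1 h1 by simp
    qed
  qed
  moreover obtain n where "(1/2) ^ n < Re \<delta>"
    using real_arch_pow_inv[of "Re \<delta>" "1/2"] assms by auto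
  moreover have "(1/2) ^ Suc n \<le> (1/2 :: real) ^ n" by simp
  ultimately show ?thesis by (meson less_imp_le order_trans)
qed

text \<open>After reduction to \<open>Re \<delta> \<ge> 1/2\<close> the exponential decay outweighs
  the power in the height.\<close>

lemma Hecke_bound:
  obtains M where "M \<ge> 0" "\<And>\<delta>. Re \<delta> > 0 \<Longrightarrow> norm (form_series \<Delta> a \<delta>) \<le> M * Re \<delta> powr (- k / 2)"
proof -
  obtain B where B: "B > 0" "\<And>\<delta>. Re \<delta> \<ge> 1/2 \<Longrightarrow> norm (form_series \<Delta> a \<delta>) \<le> B * exp (- (2 * pi * \<Delta> * Re \<delta>))"
    using form_series_decay[of "1/2"] by (metis half_gt_zero_iff zero_less_one)
  obtain C where C: "\<And>x. x \<ge> 1/2 \<Longrightarrow> x powr (k / 2) * exp (- ((2 * pi * \<Delta>) * x)) \<le> C"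
    using powr_times_exp_bounded[of "2 * pi * \<Delta>" "k / 2"] Delta_pos by auto
  have strip: "invariant_height \<delta> \<le> B * C" if "Re \<delta> \<ge> 1/2" for \<delta>
  proof -
    have "invariant_height \<delta> \<le> Re \<delta> powr (k / 2) * (B * exp (- ((2 * pi * \<Delta>) * Re \<delta>)))"
      unfolding invariant_height_def using B(2)[OF that] by (intro mult_left_mono) auto
    also have "\<dots> \<le> B * C" using C[OF that] B(1) by (simp add: mult_ac)
    finally show ?thesis .
  qed
  have h: "invariant_height \<delta> \<le> B * C" if "Re \<delta> > 0" for \<delta>
    using reduce_to_strip[OF that] strip by metis
  have "invariant_height 1 \<ge> 0" by (simp add: invariant_height_def)
  then have "B * C \<ge> 0" using h[of 1] by simp
  moreover have "norm (form_series \<Delta> a \<delta>) \<le> B * C * Re \<delta> powr (- k / 2)" if "Re \<delta> > 0" for \<delta>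
    using h[OF that] that by (simp add: invariant_height_def powr_minus field_simps)
  ultimately show ?thesis by (rule that)
qed

section \<open>Coefficient bounds and the absence of forms of nonpositive weight\<close>

text \<open>Cauchy's inequality for the power series in the nome, on the circle that is the image of
  the line \<open>Re \<delta> = x\<close>. The abscissa \<open>x\<close> stays free so that it can
  depend on \<open>n\<close> or tend to 0.\<close>

lemma coefficient_bound:
  assumes "x > 0" and B: "\<And>\<delta>. Re \<delta> = x \<Longrightarrow> norm (form_series \<Delta> a \<delta>) \<le> B"
  shows "norm (a n) \<le> B * exp (2 * pi * (\<Delta> + real n) * x)"
proof -
  define r where "r = exp (- (2 * pi * x))"
  have r: "0 < r" "ereal r < 1" using assms by (auto simp: r_def)
  have "ereal r < fps_conv_radius q_series"
    using r(2) q_series_conv_radius by (rule order_less_le_trans)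
  then have sub: "cball 0 r \<subseteq> eball (0::complex) (fps_conv_radius q_series)"
    by (auto simp: in_eball_iff) (meson ereal_less_eq(3) order_le_less_trans)
  have "norm ((deriv ^^ n) (eval_fps q_series) 0) \<le> fact n * (B * exp (2 * pi * \<Delta> * x)) / r ^ n"
  proof (rule Cauchy_inequality)
    show "eval_fps q_series holomorphic_on ball 0 r"
      using sub ball_subset_cball by (intro holomorphic_on_eval_fps) blast
    show "continuous_on (cball 0 r) (eval_fps q_series)"
      using sub continuous_on_eval_fps continuous_on_subset by blast
    fix z :: complex assume "norm (0 - z) = r"
    then have z: "norm z = r" "z \<noteq> 0" using r by auto
    \<comment> \<open>A preimage of \<open>z\<close> under the nome, lying on the line where
      \<open>B\<close> bounds the form.\<close>
    define \<delta> where "\<delta> = - Ln z / of_real (2 * pi)"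
    have "Re \<delta> = - Re (Ln z) / (2 * pi)" unfolding \<delta>_def by (subst Re_divide_of_real) simp
    then have Re: "Re \<delta> = x" using z by (simp add: r_def)
    have "nome \<delta> = z" using z by (simp add: \<delta>_def)
    then have "form_series \<Delta> a \<delta> = exp (- of_real (2 * pi * \<Delta>) * \<delta>) * eval_fps q_series z"
      using form_series_nome[of \<delta>] Re assms(1) by simp
    then have "norm (form_series \<Delta> a \<delta>) = exp (- (2 * pi * \<Delta> * x)) * norm (eval_fps q_series z)"
      by (simp add: norm_mult Re)
    then show "norm (eval_fps q_series z) \<le> B * exp (2 * pi * \<Delta> * x)"
      using mult_right_mono[OF B[OF Re], of "exp (2 * pi * \<Delta> * x)"] by (simp add: exp_minus field_simps)
  qed (use r in auto)
  moreover have "(deriv ^^ n) (eval_fps q_series) 0 / fact n = a n"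
  proof -
    have "fps_conv_radius q_series > 0" using q_series_conv_radius by (rule order_less_le_trans[rotated]) simp
    from fps_nth_fps_expansion[OF eval_fps_has_fps_expansion[OF this], of n] show ?thesis
      by (simp add: q_series_def)
  qed
  then have "norm ((deriv ^^ n) (eval_fps q_series) 0) = norm (a n) * fact n"
    by (metis fact_nonzero nonzero_eq_divide_eq norm_mult norm_fact)
  ultimately have "norm (a n) * fact n \<le> fact n * (B * exp (2 * pi * \<Delta> * x)) / r ^ n" by simp
  then have "fact n * norm (a n) \<le> fact n * (B * exp (2 * pi * \<Delta> * x) / r ^ n)" by (simp add: mult.commute)
  then have "norm (a n) \<le> B * exp (2 * pi * \<Delta> * x) / r ^ n" by (simp only: mult_le_cancel_left_pos fact_gt_zero)
  also have "r ^ n = exp (- (2 * pi * real n * x))"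
    by (simp add: r_def mult_ac flip: exp_of_nat_mult)
  also have "B * exp (2 * pi * \<Delta> * x) / exp (- (2 * pi * real n * x)) = B * exp (2 * pi * (\<Delta> + real n) * x)"
    by (simp add: exp_minus divide_inverse mult.assoc ring_distribs flip: exp_add)
  finally show ?thesis .
qed

text \<open>The choice \<open>x = 1 / (\<Delta> + real n)\<close> makes the exponential in
  \<open>coefficient_bound\<close> the constant \<open>exp (2 * pi)\<close>.\<close>

lemma coefficient_growth:
  assumes "k > 0"
  obtains M where "M \<ge> 0" "\<And>n. norm (a n) \<le> M * (\<Delta> + real n) powr (k / 2)"
proof -
  obtain M where M: "M \<ge> 0" "\<And>\<delta>. Re \<delta> > 0 \<Longrightarrow> norm (form_series \<Delta> a \<delta>) \<le> M * Re \<delta> powr (- k / 2)"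
    using Hecke_bound by blast
  have "norm (a n) \<le> (M * exp (2 * pi)) * (\<Delta> + real n) powr (k / 2)" for n
  proof -
    have l: "\<Delta> + real n > 0" using Delta_pos by simp
    have "norm (a n) \<le> (M * (1 / (\<Delta> + real n)) powr (- k / 2)) * exp (2 * pi * (\<Delta> + real n) * (1 / (\<Delta> + real n)))"
    proof (rule coefficient_bound)
      fix \<delta> assume "Re \<delta> = 1 / (\<Delta> + real n)"
      then show "norm (form_series \<Delta> a \<delta>) \<le> M * (1 / (\<Delta> + real n)) powr (- k / 2)"
        using M(2)[of \<delta>] l by simp
    qed (use l in simp)
    also have "(1 / (\<Delta> + real n)) powr (- k / 2) = (\<Delta> + real n) powr (k / 2)"
      using l by (simp add: powr_divide powr_minus)
    also have "2 * pi * (\<Delta> + real n) * (1 / (\<Delta> + real n)) = 2 * pi" using l by simp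
    finally show ?thesis by (simp add: mult_ac)
  qed
  moreover have "M * exp (2 * pi) \<ge> 0" using M(1) by simp
  ultimately show ?thesis using that by blast
qed

text \<open>In weight 0 the height is the modulus itself. If the form is nonzero somewhere,
  reduction to the strip and decay make the modulus attain its maximum in a compact rectangle; the
  form is then constant, which contradicts the decay.\<close>

lemma form_series_weight_zero:
  assumes "k = 0" "Re \<delta> > 0"
  shows "form_series \<Delta> a \<delta> = 0"
proof (rule ccontr)
  let ?F = "form_series \<Delta> a"
  assume "?F \<delta> \<noteq> 0"
  have height: "invariant_height z = norm (?F z)" if "Re z > 0" for z
    unfolding invariant_height_def using that by (simp add: assms(1))
  obtain B where B: "B > 0" "\<And>\<delta>. Re \<delta> \<ge> 1/2 \<Longrightarrow> norm (?F \<delta>) \<le> B * exp (- (2 * pi * \<Delta> * Re \<delta>))"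
    using form_series_decay[of "1/2"] by (metis half_gt_zero_iff zero_less_one)
  have "((\<lambda>x. B * exp (- (2 * pi * \<Delta> * x))) \<longlongrightarrow> B * 0) at_top"
    using Delta_pos
    by (intro tendsto_mult tendsto_const filterlim_compose[OF exp_at_bot] filterlim_compose[OF filterlim_uminus_at_bot_at_top]
        filterlim_tendsto_pos_mult_at_top[OF tendsto_const]) (auto simp: filterlim_ident)
  then have "eventually (\<lambda>x. B * exp (- (2 * pi * \<Delta> * x)) < norm (?F \<delta>)) at_top"
    using \<open>?F \<delta> \<noteq> 0\<close> by (intro order_tendstoD(2)[of _ "B * 0"]) auto
  then obtain X\<^sub>0 where X\<^sub>0: "\<And>x. x \<ge> X\<^sub>0 \<Longrightarrow> B * exp (- (2 * pi * \<Delta> * x)) < norm (?F \<delta>)"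
    by (auto simp: eventually_at_top_linorder)
  \<comment> \<open>\<open>X \<ge> 1\<close> ensures that the rectangle \<open>K\<close> contains
    the point 1.\<close>
  define X where "X = max X\<^sub>0 1"
  have far: "norm (?F z) < norm (?F \<delta>)" if "Re z \<ge> X" for z
    using that B(2)[of z] X\<^sub>0[of "Re z"] by (simp add: X_def)
  define K where "K = cbox (Complex (1/2) (-1/2)) (Complex X (1/2))"
  have K: "z \<in> K \<longleftrightarrow> 1/2 \<le> Re z \<and> Re z \<le> X \<and> \<bar>Im z\<bar> \<le> 1/2" for z
    by (auto simp: K_def in_cbox_complex_iff)
  have "continuous_on K (\<lambda>z. norm (?F z))"
    using holomorphic_on_imp_continuous_on[OF holomorphic_form_series]
    by (intro continuous_on_norm) (auto intro: continuous_on_subset simp: K)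
  moreover have "Complex 1 0 \<in> K" by (simp add: K X_def)
  ultimately obtain \<xi> where xi: "\<xi> \<in> K" "\<And>z. z \<in> K \<Longrightarrow> norm (?F z) \<le> norm (?F \<xi>)"
    using continuous_attains_sup[of K "\<lambda>z. norm (?F z)"] compact_cbox unfolding K_def by blast
  \<comment> \<open>The representative of \<open>z\<close> in the strip either lies in
    \<open>K\<close> or has real part beyond \<open>X\<close>.\<close>
  have near: "norm (?F z) \<le> norm (?F \<xi>) \<or> norm (?F z) < norm (?F \<delta>)" if z: "Re z > 0" for z
  proof -
    obtain z' where z': "Re z' \<ge> 1/2" "\<bar>Im z'\<bar> \<le> 1/2" "invariant_height z' = invariant_height z"
      using reduce_to_strip[OF z] by blast
    then have "norm (?F z) = norm (?F z')" using z by (simp add: height)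
    then show ?thesis using z' xi(2)[of z'] far[of z'] K[of z'] by (cases "Re z' \<le> X") auto
  qed
  \<comment> \<open>At \<delta> itself the second alternative of \<open>near\<close> is absurd, so
    the value at \<xi> dominates in either case.\<close>
  have max: "norm (?F z) \<le> norm (?F \<xi>)" if "Re z > 0" for z
    using near[OF that] near[OF assms(2)] by linarith
  have xi_pos: "Re \<xi> > 0" using xi(1) K by force
  have "?F constant_on {\<delta>. Re \<delta> > 0}"
    by (rule maximum_modulus_principle[OF holomorphic_form_series, of "{\<delta>. Re \<delta> > 0}" \<xi>])
       (use max xi_pos in \<open>auto simp: open_halfspace_Re_gt convex_halfspace_Re_gt convex_connected\<close>)
  then obtain c where c: "\<And>z. Re z > 0 \<Longrightarrow> ?F z = c" by (auto simp: constant_on_def)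
  have "X > 0" by (simp add: X_def)
  then have "norm (?F (of_real X)) < norm (?F \<delta>)" "?F (of_real X) = ?F \<delta>"
    using far[of "of_real X"] c[of "of_real X"] c[OF assms(2)] by auto
  then show False by simp
qed

text \<open>In negative weight the Hecke bound \<open>x powr (- k / 2)\<close> tends to 0 as
  \<open>x\<close> decreases to 0, while the exponential in \<open>coefficient_bound\<close> tends
  to 1.\<close>

lemma coefficients_vanish:
  assumes "k \<le> 0"
  shows "a n = 0"
proof (cases "k = 0")
  case True
  have "norm (a n) \<le> 0 * exp (2 * pi * (\<Delta> + real n) * 1)"
    by (rule coefficient_bound) (use form_series_weight_zero[OF True] in auto)
  then show ?thesis by simp
next
  case False
  obtain M where M: "M \<ge> 0" "\<And>\<delta>. Re \<delta> > 0 \<Longrightarrow> norm (form_series \<Delta> a \<delta>) \<le> M * Re \<delta> powr (- k / 2)"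
    using Hecke_bound by blast
  have "norm (a n) \<le> (M * x powr (- k / 2)) * exp (2 * pi * (\<Delta> + real n) * x)" if "x > 0" for x
    using that M(2) by (intro coefficient_bound) auto
  then have "eventually (\<lambda>x. norm (a n) \<le> (M * x powr (- k / 2)) * exp (2 * pi * (\<Delta> + real n) * x)) (at_right 0)"
    by (auto simp: eventually_at_filter)
  moreover have "((\<lambda>x. (M * x powr (- k / 2)) * exp (2 * pi * (\<Delta> + real n) * x)) \<longlongrightarrow>
      (M * 0 powr (- k / 2)) * exp (2 * pi * (\<Delta> + real n) * 0)) (at_right 0)"
    using assms False
    by (intro tendsto_intros tendsto_powr2) (auto simp: eventually_at_filter)
  ultimately have "norm (a n) \<le> (M * 0 powr (- k / 2)) * exp (2 * pi * (\<Delta> + real n) * 0)"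
    by (intro tendsto_lowerbound) auto
  then show ?thesis by simp
qed

section \<open>The form in the logarithmic coordinate\<close>

lemma form_series_exp_uminus:
  "form_series \<Delta> a (of_real (exp (- x))) = exp (of_real k * of_real x) * form_series \<Delta> a (of_real (exp x))"
proof -
  have "form_series \<Delta> a (1 / of_real (exp x)) = of_real (exp x) powr of_real k * form_series \<Delta> a (of_real (exp x))"
    by (rule form_series_inverse) simp
  moreover have "1 / complex_of_real (exp x) = of_real (exp (- x))"
    by (simp add: exp_minus divide_inverse)
  moreover have "complex_of_real (exp x) powr of_real k = exp (of_real k * of_real x)"
    by (simp only: powr_of_real exp_ge_zero) (simp add: powr_def exp_of_real flip: of_real_mult)
  ultimately show ?thesis by (simp only:)
qed

text \<open>For \<open>x \<ge> 0\<close> the decay is exponential in \<open>exp x\<close>, which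
  exceeds \<open>x\<^sup>2 / 2\<close>; negative \<open>x\<close> is reflected to this case by
  inversion, at the price of an exponential factor.\<close>

lemma form_series_exp_gauss_dominated: "gauss_dominated (\<lambda>x. form_series \<Delta> a (of_real (exp x)))"
proof -
  obtain B where B: "B > 0" "\<And>\<delta>. Re \<delta> \<ge> 1/2 \<Longrightarrow> norm (form_series \<Delta> a \<delta>) \<le> B * exp (- (2 * pi * \<Delta> * Re \<delta>))"
    using form_series_decay[of "1/2"] by (metis half_gt_zero_iff zero_less_one)
  have pos: "norm (form_series \<Delta> a (of_real (exp x))) \<le> B * exp (- (pi * \<Delta>) * x\<^sup>2)" if "x \<ge> 0" for x
  proof -
    have "x\<^sup>2 / 2 \<le> exp x" using exp_lower_Taylor_quadratic[OF that] that by linarith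
    then have "2 * pi * \<Delta> * (x\<^sup>2 / 2) \<le> 2 * pi * \<Delta> * exp x"
      using Delta_pos by (intro mult_left_mono) auto
    then have "B * exp (- (2 * pi * \<Delta> * exp x)) \<le> B * exp (- (pi * \<Delta>) * x\<^sup>2)"
      using B(1) by simp
    moreover have "norm (form_series \<Delta> a (of_real (exp x))) \<le> B * exp (- (2 * pi * \<Delta> * exp x))"
    proof -
      have "1 \<le> exp x" using that by simp
      then have "1 / 2 \<le> Re (of_real (exp x))" unfolding Re_complex_of_real by linarith
      from B(2)[OF this] show ?thesis by simp
    qed
    ultimately show ?thesis by linarith
  qed
  show ?thesis
  proof (rule gauss_dominatedI)
    show "pi * \<Delta> > 0" using Delta_pos by simp
    show "(\<lambda>x. form_series \<Delta> a (of_real (exp x))) \<in> borel_measurable borel"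
      unfolding form_series_def form_term_def by measurable
    fix x
    show "norm (form_series \<Delta> a (of_real (exp x))) \<le> B * exp (\<bar>k\<bar> * \<bar>x\<bar>) * exp (- (pi * \<Delta>) * x\<^sup>2)"
    proof (cases "x \<ge> 0")
      case True
      have "B * exp (- (pi * \<Delta>) * x\<^sup>2) * 1 \<le> B * exp (- (pi * \<Delta>) * x\<^sup>2) * exp (\<bar>k\<bar> * \<bar>x\<bar>)"
        using B(1) by (intro mult_left_mono) auto
      then show ?thesis using pos[OF True] by (simp add: mult_ac)
    next
      case False
      have "norm (form_series \<Delta> a (of_real (exp x))) = exp (k * (- x)) * norm (form_series \<Delta> a (of_real (exp (- x))))"
        using form_series_exp_uminus[of "- x"] by (simp add: norm_mult)
      also have "\<dots> \<le> exp (\<bar>k\<bar> * \<bar>x\<bar>) * (B * exp (- (pi * \<Delta>) * (- x)\<^sup>2))"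
        using False by (intro mult_mono pos) (auto intro: mult_right_mono)
      finally show ?thesis by (simp add: mult_ac)
    qed
  qed
qed

end

subsection \<open>Mellin transforms\<close>

lemma TTbar_term_of_real:
  assumes "\<alpha> > 0" "\<Delta> > 0" "t > 0"
  shows "TTbar_term \<alpha> k \<Delta> a n (of_real t) = a n * of_real (tt_symbol \<alpha> k (2 * pi * (\<Delta> + real n) * t))"
proof -
  define w where "w = sqrt (1 + 4 * \<alpha> * (2 * pi * (\<Delta> + real n) * t))"
  have w: "w \<ge> 0" by (simp add: w_def assms less_imp_le)
  have "1 + complex_of_real (8 * pi * (\<Delta> + real n) * \<alpha>) * of_real t = of_real (1 + 4 * \<alpha> * (2 * pi * (\<Delta> + real n) * t))"
    by (simp add: algebra_simps)
  then have root: "TTbar_root \<alpha> \<Delta> n (of_real t) = of_real w"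
    unfolding TTbar_root_def w_def using assms by (subst of_real_sqrt) (auto intro!: add_nonneg_nonneg mult_nonneg_nonneg)
  have "(1 + complex_of_real w) powr of_real (1 - k) = of_real ((1 + w) powr (1 - k))"
    using w powr_of_real[of "1 + w" "1 - k"] by simp
  moreover have "exp (- complex_of_real (1 / (2 * \<alpha>)) * (of_real w - 1)) = of_real (exp (- (w - 1) / (2 * \<alpha>)))"
  proof -
    have "- complex_of_real (1 / (2 * \<alpha>)) * (of_real w - 1) = of_real (- (1 / (2 * \<alpha>)) * (w - 1))"
      by (simp only: of_real_mult of_real_diff of_real_minus of_real_1)
    also have "- (1 / (2 * \<alpha>)) * (w - 1) = - (w - 1) / (2 * \<alpha>)" by (simp add: diff_divide_distrib)
    finally show ?thesis by (simp only: exp_of_real)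
  qed
  ultimately show ?thesis
    unfolding TTbar_term_def root tt_symbol_def Let_def w_def[symmetric] by simp
qed

text \<open>The real part of the root grows at least like \<open>sqrt (\<Delta> + real n)\<close>,
  which controls the exponential. Stated for complex \<delta>, since the deformed series must
  converge on the whole half-plane.\<close>

lemma norm_TTbar_term_le:
  assumes "\<alpha> > 0" "k > 0" "\<Delta> > 0" "Re \<delta> > 0"
  shows "norm (TTbar_term \<alpha> k \<Delta> a n \<delta>) \<le> norm (a n) *
    (2 * exp (1 / (2 * \<alpha>)) * exp (- (sqrt (4 * pi * \<alpha> * Re \<delta>) / (2 * \<alpha>) * sqrt (\<Delta> + real n))))"
proof -
  define z where "z = 1 + complex_of_real (8 * pi * (\<Delta> + real n) * \<alpha>) * \<delta>"
  define w where "w = csqrt z"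
  have Rez: "Re z = 1 + 8 * pi * (\<Delta> + real n) * \<alpha> * Re \<delta>" by (simp add: z_def)
  have z1: "Re z \<ge> 1" using assms by (simp add: Rez)
  have nz: "norm z \<ge> Re z" by (rule complex_Re_le_cmod)
  have Rew: "Re w = sqrt ((norm z + Re z) / 2)" by (simp add: w_def)
  have "4 * pi * \<alpha> * Re \<delta> * (\<Delta> + real n) \<le> (norm z + Re z) / 2"
    using nz Rez z1 by (simp add: mult_ac)
  then have "sqrt (4 * pi * \<alpha> * Re \<delta> * (\<Delta> + real n)) \<le> Re w"
    unfolding Rew by (rule real_sqrt_le_mono)
  then have Rew_ge: "sqrt (4 * pi * \<alpha> * Re \<delta>) * sqrt (\<Delta> + real n) \<le> Re w"
    by (simp add: real_sqrt_mult)
  have w1: "norm w \<ge> 1" using nz z1 by (simp add: w_def)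
  have "Re w \<ge> 0" unfolding w_def by (rule Re_csqrt)
  then have "Re (1 + w) \<ge> 1" by simp
  then have "norm (1 + w) \<ge> 1" using complex_Re_le_cmod[of "1 + w"] by linarith
  \<comment> \<open>The base is at least 1 and \<open>1 - k \<le> 1\<close>; the single power that
    remains is absorbed by the denominator \<open>norm w\<close>.\<close>
  then have "norm (1 + w) powr (1 - k) \<le> norm (1 + w) powr 1"
    using assms by (intro powr_mono) auto
  also have "\<dots> \<le> 2 * norm w"
    using norm_triangle_ineq[of 1 w] w1 by simp
  finally have factor: "norm (1 + w) powr (1 - k) / norm w \<le> 2"
    using w1 by (simp add: divide_le_eq)
  have "norm (TTbar_term \<alpha> k \<Delta> a n \<delta>) = norm (a n) * ((norm (1 + w) powr (1 - k) / norm w) * exp (- (1 / (2 * \<alpha>)) * (Re w - 1)))"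
    unfolding TTbar_term_def TTbar_root_def z_def[symmetric] w_def[symmetric]
    by (simp add: norm_mult norm_divide norm_powr_real_powr')
  also have "exp (- (1 / (2 * \<alpha>)) * (Re w - 1)) \<le> exp (1 / (2 * \<alpha>)) * exp (- (sqrt (4 * pi * \<alpha> * Re \<delta>) / (2 * \<alpha>) * sqrt (\<Delta> + real n)))"
    unfolding exp_add[symmetric] using Rew_ge assms by (simp add: field_simps)
  then have "(norm (1 + w) powr (1 - k) / norm w) * exp (- (1 / (2 * \<alpha>)) * (Re w - 1))
     \<le> 2 * (exp (1 / (2 * \<alpha>)) * exp (- (sqrt (4 * pi * \<alpha> * Re \<delta>) / (2 * \<alpha>) * sqrt (\<Delta> + real n))))"
    using factor by (intro mult_mono) auto
  finally show ?thesis by (simp add: mult_left_mono mult.assoc)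
qed

lemma (in modular_form) abs_summable_TTbar_term:
  assumes "\<alpha> > 0" "k > 0" "Re \<delta> > 0"
  shows "summable (\<lambda>n. norm (TTbar_term \<alpha> k \<Delta> a n \<delta>))"
proof -
  obtain M where M: "M \<ge> 0" "\<And>n. norm (a n) \<le> M * (\<Delta> + real n) powr (k / 2)"
    using coefficient_growth[OF assms(2)] by blast
  define d where "d = sqrt (4 * pi * \<alpha> * Re \<delta>) / (2 * \<alpha>)"
  have d: "d > 0" using assms by (simp add: d_def)
  let ?C = "2 * exp (1 / (2 * \<alpha>))"
  show ?thesis
  proof (rule summable_comparison_test')
    show "summable (\<lambda>n. (M * ?C) * ((\<Delta> + real n) powr (k / 2) * exp (- (d * sqrt (\<Delta> + real n)))))"
      using d Delta_pos by (intro summable_mult summable_powr_times_exp_sqrt)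
    fix n :: nat
    have "norm (TTbar_term \<alpha> k \<Delta> a n \<delta>) \<le> norm (a n) * (?C * exp (- (d * sqrt (\<Delta> + real n))))"
      unfolding d_def using assms Delta_pos by (intro norm_TTbar_term_le)
    also have "\<dots> \<le> (M * (\<Delta> + real n) powr (k / 2)) * (?C * exp (- (d * sqrt (\<Delta> + real n))))"
      by (intro mult_right_mono M) simp
    finally show "norm (norm (TTbar_term \<alpha> k \<Delta> a n \<delta>)) \<le> (M * ?C) * ((\<Delta> + real n) powr (k / 2) * exp (- (d * sqrt (\<Delta> + real n))))"
      by (simp add: mult_ac)
  qed
qed

text \<open>The kernel representation is applied termwise. As the kernel is nonnegative, the
  integral of the norm of each term is exactly the norm of the deformed term, so the interchange
  follows from absolute convergence of the deformed series.\<close>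

lemma (in modular_form) TTbar_deformation_eq_integral:
  assumes "\<alpha> > 0" "k > 0"
  shows "TTbar_deformation \<alpha> k \<Delta> a (of_real (exp x)) =
    (\<integral>y. of_real (tt_kernel \<alpha> k y) * form_series \<Delta> a (of_real (exp (x + 2 * y))) \<partial>lborel)"
proof -
  define X where "X n = 2 * pi * (\<Delta> + real n) * exp x" for n
  have X: "X n \<ge> 0" for n using Delta_pos by (simp add: X_def)
  define u where "u n y = complex_of_real (tt_kernel \<alpha> k y) * form_term \<Delta> a n (of_real (exp (x + 2 * y)))" for n y
  have u: "u n y = a n * of_real (exp (- X n * exp (2 * y)) * tt_kernel \<alpha> k y)" for n y
  proof -
    have "form_term \<Delta> a n (of_real (exp (x + 2 * y))) = a n * of_real (exp (- X n * exp (2 * y)))"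
      by (simp add: form_term_def X_def exp_add mult_ac flip: exp_of_real)
    then show ?thesis by (simp add: u_def)
  qed
  have bochner: "has_bochner_integral lborel (\<lambda>y. exp (- X n * exp (2 * y)) * tt_kernel \<alpha> k y) (tt_symbol \<alpha> k (X n))" for n
    using assms X by (rule tt_kernel_laplace)
  have symbol_nonneg: "tt_symbol \<alpha> k (X n) \<ge> 0" for n
    using X[of n] assms by (simp add: tt_symbol_def Let_def)
  have term_eq: "TTbar_term \<alpha> k \<Delta> a n (of_real (exp x)) = a n * of_real (tt_symbol \<alpha> k (X n))" for n
    unfolding X_def using assms(1) Delta_pos by (intro TTbar_term_of_real) auto
  have u_int: "integrable lborel (u n)" "integral\<^sup>L lborel (u n) = TTbar_term \<alpha> k \<Delta> a n (of_real (exp x))" for n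
    using bochner[of n] unfolding u[abs_def] has_bochner_integral_iff by (auto simp: term_eq simp del: of_real_mult)
  have u_norm: "(\<integral>y. norm (u n y) \<partial>lborel) = norm (TTbar_term \<alpha> k \<Delta> a n (of_real (exp x)))" for n
  proof -
    have "norm (u n y) = norm (a n) * (exp (- X n * exp (2 * y)) * tt_kernel \<alpha> k y)" for y
      using tt_kernel_nonneg[OF assms, of y] by (simp add: u norm_mult)
    then show ?thesis using bochner[of n] symbol_nonneg[of n]
      by (simp add: has_bochner_integral_iff term_eq norm_mult)
  qed
  have "(\<lambda>n. integral\<^sup>L lborel (u n)) sums (\<integral>y. (\<Sum>n. u n y) \<partial>lborel)"
  proof (rule sums_integral[OF u_int(1)])
    show "AE y in lborel. summable (\<lambda>n. norm (u n y))"
      unfolding u_def norm_mult by (intro always_eventually allI summable_mult abs_summable_form_term) simp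
    show "summable (\<lambda>n. \<integral>y. norm (u n y) \<partial>lborel)"
      unfolding u_norm using assms by (intro abs_summable_TTbar_term) auto
  qed
  moreover have "(\<Sum>n. u n y) = of_real (tt_kernel \<alpha> k y) * form_series \<Delta> a (of_real (exp (x + 2 * y)))" for y
    unfolding u_def form_series_def by (intro suminf_mult summable_form_term) simp
  ultimately show ?thesis by (simp add: u_int(2) TTbar_deformation_def sums_iff)
qed

lemma mellin_transform_exp:
  assumes "\<And>x. f (of_real (exp x)) = G x" and int: "integrable lborel (\<lambda>x. exp (s * of_real x) * G x)"
  shows "set_integrable lborel {0<..} (mellin_integrand f s)"
    and "(LINT \<delta>:{0<..}|lborel. mellin_integrand f s \<delta>) = laplace2 G s"
proof -
  \<comment> \<open>Nothing is known about \<open>f\<close> off the positive axis; \<open>h\<close>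
    agrees with the Mellin integrand there and is Borel measurable on all of the line.\<close>
  define h where "h \<delta> = (exp (s * of_real (ln \<delta>)) * G (ln \<delta>)) / of_real \<delta>" for \<delta> :: real
  have [measurable]: "(\<lambda>x. exp (s * of_real x) * G x) \<in> borel_measurable borel"
    using int by auto
  have [measurable]: "h \<in> borel_measurable borel"
  proof -
    have "(\<lambda>\<delta>::real. (\<lambda>x. exp (s * of_real x) * G x) (ln \<delta>) / of_real \<delta>) \<in> borel_measurable borel"
      by measurable
    then show ?thesis by (simp add: h_def[abs_def])
  qed
  have eq: "exp x *\<^sub>R h (exp x) = exp (s * of_real x) * G x" for x
    by (simp add: h_def scaleR_conv_of_real)
  have range: "range exp = {0 :: real <..}"
    using exp_total by (auto simp: image_iff)
  have cov: "set_integrable lborel {0<..} h \<longleftrightarrow> integrable lborel (\<lambda>x. exp x *\<^sub>R h (exp x))"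
      "(LINT \<delta>:{0<..}|lborel. h \<delta>) = (\<integral>x. exp x *\<^sub>R h (exp x) \<partial>lborel)"
    using range by (intro lborel_change_of_variables; auto intro: DERIV_exp injI)+
  have mh: "mellin_integrand f s \<delta> = h \<delta>" if "\<delta> > 0" for \<delta>
  proof -
    have "f (of_real \<delta>) = G (ln \<delta>)" using assms(1)[of "ln \<delta>"] that by simp
    moreover have "of_real \<delta> powr (s - 1) = exp (s * of_real (ln \<delta>)) / of_real \<delta>"
    proof -
      have "of_real \<delta> powr (s - 1) = exp (s * of_real (ln \<delta>) - of_real (ln \<delta>))"
        using that by (simp add: powr_def Ln_of_real left_diff_distrib)
      also have "\<dots> = exp (s * of_real (ln \<delta>)) / of_real (exp (ln \<delta>))"
        by (simp only: exp_diff exp_of_real)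
      finally show ?thesis using that by simp
    qed
    ultimately show ?thesis by (simp add: mellin_integrand_def h_def)
  qed
  have "set_integrable lborel {0<..} (mellin_integrand f s) \<longleftrightarrow> set_integrable lborel {0<..} h"
    by (intro set_integrable_cong) (auto simp: mh)
  then show "set_integrable lborel {0<..} (mellin_integrand f s)"
    using cov(1) int by (simp add: eq)
  have "(LINT \<delta>:{0<..}|lborel. mellin_integrand f s \<delta>) = (LINT \<delta>:{0<..}|lborel. h \<delta>)"
    by (intro set_lebesgue_integral_cong) (auto simp: mh)
  then show "(LINT \<delta>:{0<..}|lborel. mellin_integrand f s \<delta>) = laplace2 G s"
    using cov(2) by (simp add: eq laplace2_def)
qed

section \<open>The universal factor and its symmetry\<close>

text \<open>The convolution evaluates the kernel transform at \<open>- 2 * s\<close>, and the weight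
  \<open>exp (k * y)\<close> shifts this to \<open>k - 2 * s\<close>. Isolating the even part makes
  the reflection visible: replacing \<open>s\<close> by \<open>k - s\<close> negates the
  argument.\<close>

definition tt_factor :: "real \<Rightarrow> real \<Rightarrow> complex \<Rightarrow> complex" where
  "tt_factor \<alpha> k s = laplace2 (\<lambda>y. of_real (tt_profile \<alpha> k (2 * cosh y) / tt_norm \<alpha> k)) (of_real k - 2 * s)"

lemma tt_factor_holomorphic:
  assumes "\<alpha> > 0" "k > 0"
  shows "tt_factor \<alpha> k holomorphic_on UNIV"
proof -
  have "laplace2 (\<lambda>y. of_real (tt_profile \<alpha> k (2 * cosh y) / tt_norm \<alpha> k)) \<circ> (\<lambda>s. of_real k - 2 * s) holomorphic_on UNIV"
    by (intro holomorphic_on_compose_gen[OF _ laplace2_holomorphic[OF tt_even_kernel_gauss_dominated[OF assms]]] holomorphic_intros) auto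
  then show ?thesis by (simp add: tt_factor_def[abs_def] comp_def)
qed

lemma tt_factor_reflect: "tt_factor \<alpha> k (of_real k - s) = tt_factor \<alpha> k s"
proof -
  have "of_real k - 2 * (of_real k - s) = - (of_real k - 2 * s)" by simp
  then show ?thesis
    unfolding tt_factor_def by (simp only: laplace2_reflect[symmetric] cosh_minus)
qed

lemma tt_kernel_gauss_dominated:
  assumes "\<alpha> > 0" "k > 0"
  shows "gauss_dominated (\<lambda>y. of_real (tt_kernel \<alpha> k y))"
proof -
  have "(\<lambda>y. complex_of_real (tt_kernel \<alpha> k y)) =
      (\<lambda>y. exp (of_real k * of_real y) * of_real (tt_profile \<alpha> k (2 * cosh y) / tt_norm \<alpha> k))"
    by (simp add: tt_kernel_def fun_eq_iff exp_of_real flip: of_real_mult)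
  then show ?thesis
    using gauss_dominated_exp_mult[OF tt_even_kernel_gauss_dominated[OF assms]] by simp
qed

text \<open>Both Mellin integrals converge for every \<open>s\<close>, so each analytic continuation
  is given by its integral on the whole plane. The reflection of \<open>R\<close> is inversion of
  the form, read as \<open>x \<mapsto> - x\<close>.\<close>

lemma (in modular_form) mellin_transforms:
  assumes "\<alpha> > 0" "k > 0"
  defines "R \<equiv> laplace2 (\<lambda>x. form_series \<Delta> a (of_real (exp x)))"
  shows "is_mellin_transform k (form_series \<Delta> a) R"
    and "is_mellin_transform k (TTbar_deformation \<alpha> k \<Delta> a) (\<lambda>s. tt_factor \<alpha> k s * R s)"
    and "R (of_real k - s) = R s"
proof -
  let ?f = "\<lambda>x. form_series \<Delta> a (of_real (exp x))"
  let ?v = "\<lambda>y. complex_of_real (tt_kernel \<alpha> k y)"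
  note f = form_series_exp_gauss_dominated
  have holR: "R holomorphic_on UNIV" unfolding R_def by (rule laplace2_holomorphic[OF f])
  show "is_mellin_transform k (form_series \<Delta> a) R"
    unfolding is_mellin_transform_def R_def
    using laplace2_holomorphic[OF f] mellin_transform_exp[OF refl gauss_dominated_integrable[OF f]] by simp
  let ?G = "\<lambda>x. \<integral>y. ?v y * ?f (x + 2 * y) \<partial>lborel"
  have v: "laplace2 ?v (- 2 * s) = tt_factor \<alpha> k s" for s
  proof -
    have "?v = (\<lambda>y. exp (of_real k * of_real y) * of_real (tt_profile \<alpha> k (2 * cosh y) / tt_norm \<alpha> k))"
      by (simp add: tt_kernel_def fun_eq_iff exp_of_real flip: of_real_mult)
    then show ?thesis by (simp only: laplace2_exp_mult tt_factor_def) (simp add: algebra_simps)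
  qed
  note conv = laplace2_convolution[OF tt_kernel_gauss_dominated[OF assms(1,2)] f]
  show "is_mellin_transform k (TTbar_deformation \<alpha> k \<Delta> a) (\<lambda>s. tt_factor \<alpha> k s * R s)"
    unfolding is_mellin_transform_def
  proof (intro conjI allI impI)
    show "(\<lambda>s. tt_factor \<alpha> k s * R s) holomorphic_on UNIV"
      by (intro holomorphic_intros holR tt_factor_holomorphic assms)
    fix s
    note mellin = mellin_transform_exp[of "TTbar_deformation \<alpha> k \<Delta> a" ?G, OF TTbar_deformation_eq_integral[OF assms(1,2)] conv(1)]
    show "set_integrable lborel {0<..} (mellin_integrand (TTbar_deformation \<alpha> k \<Delta> a) s)"
      by (rule mellin(1))
    show "tt_factor \<alpha> k s * R s = (LINT \<delta>:{0<..}|lborel. mellin_integrand (TTbar_deformation \<alpha> k \<Delta> a) s \<delta>)"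
      unfolding mellin(2) conv(2) v R_def ..
  qed
  have "R (of_real k - s) = laplace2 (\<lambda>x. exp (of_real k * of_real x) * ?f x) (- s)"
    unfolding R_def laplace2_exp_mult by simp
  also have "(\<lambda>x. exp (of_real k * of_real x) * ?f x) = (\<lambda>x. ?f (- x))"
    using form_series_exp_uminus by simp
  also have "laplace2 (\<lambda>x. ?f (- x)) (- s) = R s"
    unfolding laplace2_reflect[of ?f] R_def by simp
  finally show "R (of_real k - s) = R s" .
qed

lemma (in modular_form) mellin_transforms_trivial:
  assumes "k \<le> 0"
  shows "is_mellin_transform k (form_series \<Delta> a) (\<lambda>_. 0)"
    and "is_mellin_transform k (TTbar_deformation \<alpha> k \<Delta> a) (\<lambda>_. 0)"
    and "summable (\<lambda>n. TTbar_term \<alpha> k \<Delta> a n \<delta>)"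
  using coefficients_vanish[OF assms]
  by (simp_all add: is_mellin_transform_def form_series_def[abs_def] form_term_def TTbar_deformation_def[abs_def]
      TTbar_term_def mellin_integrand_def[abs_def] set_integrable_def set_lebesgue_integral_def)

theorem mainTheorem2:
  fixes \<alpha> k :: real
  assumes "\<alpha> > 0"
  shows "\<exists>I :: complex \<Rightarrow> complex.
           I holomorphic_on UNIV \<and>
           (\<forall>s. I s = I (complex_of_real k - s)) \<and>
           (\<forall>\<Delta> a. modular_form_data k \<Delta> a \<longrightarrow>
              (\<forall>\<delta>. Re \<delta> > 0 \<longrightarrow> summable (\<lambda>n. TTbar_term \<alpha> k \<Delta> a n \<delta>)) \<and>
              (\<exists>R0 R\<alpha>.
                 is_mellin_transform k (form_series \<Delta> a) R0 \<and>
                 is_mellin_transform k (TTbar_deformation \<alpha> k \<Delta> a) R\<alpha> \<and>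
                 (\<forall>s. R\<alpha> s = I s * R0 s) \<and>
                 (\<forall>s. R\<alpha> s = R\<alpha> (complex_of_real k - s)) \<and>
                 (\<forall>s. R0 s = 0 \<longrightarrow> R\<alpha> s = 0)))"
proof (cases "k > 0")
  case True
  show ?thesis
  \<comment> \<open>The witness is built from \<alpha> and \<open>k\<close> alone and is fixed
    before the form, which is the universality claimed.\<close>
  proof (rule exI[of _ "tt_factor \<alpha> k"], intro conjI allI impI)
    fix \<Delta> :: real and a :: "nat \<Rightarrow> complex"
    assume "modular_form_data k \<Delta> a"
    then interpret modular_form k \<Delta> a by unfold_locales
    show "summable (\<lambda>n. TTbar_term \<alpha> k \<Delta> a n \<delta>)" if "Re \<delta> > 0" for \<delta>
      using abs_summable_TTbar_term[OF assms True that] by (rule summable_norm_cancel)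
    show "\<exists>R0 R\<alpha>.
                 is_mellin_transform k (form_series \<Delta> a) R0 \<and>
                 is_mellin_transform k (TTbar_deformation \<alpha> k \<Delta> a) R\<alpha> \<and>
                 (\<forall>s. R\<alpha> s = tt_factor \<alpha> k s * R0 s) \<and>
                 (\<forall>s. R\<alpha> s = R\<alpha> (complex_of_real k - s)) \<and>
                 (\<forall>s. R0 s = 0 \<longrightarrow> R\<alpha> s = 0)"
      using mellin_transforms[OF assms True]
      by (intro exI[of _ "laplace2 (\<lambda>x. form_series \<Delta> a (of_real (exp x)))"]
          exI[of _ "\<lambda>s. tt_factor \<alpha> k s * laplace2 (\<lambda>x. form_series \<Delta> a (of_real (exp x))) s"])
        (auto simp: tt_factor_reflect)
  qed (use tt_factor_holomorphic[OF assms True] tt_factor_reflect in auto)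
next
  case False
  then have k: "k \<le> 0" by simp
  show ?thesis
  proof (rule exI[of _ "\<lambda>_. 0"], intro conjI allI impI)
    fix \<Delta> :: real and a :: "nat \<Rightarrow> complex"
    assume "modular_form_data k \<Delta> a"
    then interpret modular_form k \<Delta> a by unfold_locales
    show "summable (\<lambda>n. TTbar_term \<alpha> k \<Delta> a n \<delta>)" for \<delta>
      by (rule mellin_transforms_trivial(3)[OF k])
    show "\<exists>R0 R\<alpha>.
                 is_mellin_transform k (form_series \<Delta> a) R0 \<and>
                 is_mellin_transform k (TTbar_deformation \<alpha> k \<Delta> a) R\<alpha> \<and>
                 (\<forall>s. R\<alpha> s = 0 * R0 s) \<and>
                 (\<forall>s. R\<alpha> s = R\<alpha> (complex_of_real k - s)) \<and>
                 (\<forall>s. R0 s = 0 \<longrightarrow> R\<alpha> s = 0)"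
      by (intro exI[of _ "\<lambda>_. 0"]) (simp add: mellin_transforms_trivial(1,2)[OF k])
  qed auto
qed

end
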